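(* Let $\mathfrak{P}$ be a compactness-like topological property and let $X$ and $Y$ be locally-$\mathfrak{P}$ spaces, neither of which has $\mathfrak{P}$. If $(\mathscr{E}_\mathfrak{P}(X),\leq)$ and $(\mathscr{E}_\mathfrak{P}(Y),\leq)$ are order-isomorphic, then $\beta X\setminus\lambda_\mathfrak{P}X$ and $\beta Y\setminus\lambda_\mathfrak{P}Y$ are homeomorphic.
   Context: All spaces are completely regular Hausdorff; $\beta X$ is the Stone–Čech compactification. An extension of $X$ is a space containing $X$ as a dense subspace; its remainder is $Y\setminus X$. Extensions are identified up to homeomorphisms fixing $X$ pointwise, and $Y\leq Y'$ means there is a continuous map $Y'\to Y$ fixing $X$ pointwise. For a topological property $\mathfrak{P}$, $\mathscr{E}_\mathfrak{P}(X)$ is the set of all extensions of $X$ with $\mathfrak{P}$ and compact remainder, ordered by $\leq$. $X$ is locally-$\mathfrak{P}$ if each point has an open neighborhood whose closure has $\mathfrak{P}$. $\mathrm{Coz}(X)$ is the set of cozero-sets $X\setminus f^{-1}(0)$, $f:X\to[0,1]$ continuous. Define $\lambda_\mathfrak{P}X=\bigcup\{\mathrm{int}_{\beta X}\mathrm{cl}_{\beta X}C: C\in\mathrm{Coz}(X),\ \mathrm{cl}_XC\text{ has }\mathfrak{P}\}$. A topological property $\mathfrak{P}$ is compactness-like if: it is hereditary to clopen subspaces; it is finitely additive (a space that is a finite disjoint union of closed subspaces each with $\mathfrak{P}$ has $\mathfrak{P}$); it is invariant and inverse invariant under perfect surjections (closed continuous surjections with compact fibers); and it satisfies Mrówka's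 condition (W): if a space $Z$ has a point $p$ with an open base $\mathscr{B}$ at $p$ such that $Z\setminus B$ has $\mathfrak{P}$ for every $B\in\mathscr{B}$, then $Z$ has $\mathfrak{P}$. *)

theory Defs
  imports "HOL-Analysis.Analysis"
begin

text \<open>Standing convention: all spaces are completely regular Hausdorff (Tychonoff).\<close>
definition tych :: "'a topology \<Rightarrow> bool" where
  "tych X \<longleftrightarrow> completely_regular_space X \<and> Hausdorff_space X"

text \<open>A topological property is represented by a predicate on spaces of a universe type 'u;
  a space of any other type has the property iff it is homeomorphic to a 'u-space having it.\<close>
definition hasP :: "('u topology \<Rightarrow> bool) \<Rightarrow> 'x topology \<Rightarrow> bool" where
  "hasP P S \<longleftrightarrow> (\<exists>U. P U \<and> S homeomorphic_space U)"

definition compactness_like :: "('u topology \<Rightarrow> bool) \<Rightarrow> bool" where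
  "compactness_like P \<longleftrightarrow>
    \<comment> \<open>hereditary to clopen subspaces\<close>
    (\<forall>Z A. tych Z \<and> P Z \<and> closedin Z A \<and> openin Z A \<longrightarrow> P (subtopology Z A)) \<and>
    \<comment> \<open>finitely additive\<close>
    (\<forall>Z F. tych Z \<and> finite F \<and> F \<noteq> {} \<and> pairwise disjnt F \<and> \<Union>F = topspace Z \<and>
        (\<forall>A\<in>F. closedin Z A \<and> P (subtopology Z A)) \<longrightarrow> P Z) \<and>
    \<comment> \<open>invariant and inverse invariant under perfect surjections\<close>
    (\<forall>Z W f. tych Z \<and> tych W \<and> perfect_map Z W f \<longrightarrow> (P Z \<longleftrightarrow> P W)) \<and>
    \<comment> \<open>Mrowka's condition (W)\<close>
    (\<forall>Z p B. tych Z \<and> p \<in> topspace Z \<and> (\<forall>V\<in>B. openin Z V \<and> p \<in> V) \<and>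
        (\<forall>U. openin Z U \<and> p \<in> U \<longrightarrow> (\<exists>V\<in>B. V \<subseteq> U)) \<and>
        (\<forall>V\<in>B. P (subtopology Z (topspace Z - V))) \<longrightarrow> P Z)"

definition locally_P :: "('u topology \<Rightarrow> bool) \<Rightarrow> 'a topology \<Rightarrow> bool" where
  "locally_P P X \<longleftrightarrow>
    (\<forall>x\<in>topspace X. \<exists>U. openin X U \<and> x \<in> U \<and> hasP P (subtopology X (X closure_of U)))"

definition is_ext :: "'a topology \<Rightarrow> 'e topology \<Rightarrow> ('a \<Rightarrow> 'e) \<Rightarrow> bool" where
  "is_ext X T e \<longleftrightarrow> tych T \<and> embedding_map X T e \<and> T closure_of (e ` topspace X) = topspace T"

definition EP_reps :: "('u topology \<Rightarrow> bool) \<Rightarrow> 'a topology \<Rightarrow> ('e topology \<times> ('a \<Rightarrow> 'e)) set" where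
  "EP_reps P X = {(T, e). is_ext X T e \<and> hasP P T \<and> compactin T (topspace T - e ` topspace X)}"

definition ext_le :: "'a topology \<Rightarrow> ('e topology \<times> ('a \<Rightarrow> 'e)) \<Rightarrow> ('e topology \<times> ('a \<Rightarrow> 'e)) \<Rightarrow> bool" where
  "ext_le X E E' \<longleftrightarrow> (\<exists>f. continuous_map (fst E') (fst E) f \<and>
      (\<forall>x\<in>topspace X. f (snd E' x) = snd E x))"

definition ext_eq :: "'a topology \<Rightarrow> ('e topology \<times> ('a \<Rightarrow> 'e)) \<Rightarrow> ('e topology \<times> ('a \<Rightarrow> 'e)) \<Rightarrow> bool" where
  "ext_eq X E E' \<longleftrightarrow> (\<exists>h. homeomorphic_map (fst E) (fst E') h \<and>
      (\<forall>x\<in>topspace X. h (snd E x) = snd E' x))"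

definition EP :: "('u topology \<Rightarrow> bool) \<Rightarrow> 'a topology \<Rightarrow> ('e topology \<times> ('a \<Rightarrow> 'e)) set set" where
  "EP P X = (\<lambda>E. {E' \<in> EP_reps P X. ext_eq X E E'}) ` EP_reps P X"

definition EP_le :: "'a topology \<Rightarrow> ('e topology \<times> ('a \<Rightarrow> 'e)) set \<Rightarrow> ('e topology \<times> ('a \<Rightarrow> 'e)) set \<Rightarrow> bool" where
  "EP_le X A B \<longleftrightarrow> (\<exists>E\<in>A. \<exists>E'\<in>B. ext_le X E E')"

definition order_isomorphic_EP ::
  "'a topology \<Rightarrow> ('e topology \<times> ('a \<Rightarrow> 'e)) set set \<Rightarrow> 'b topology \<Rightarrow> ('f topology \<times> ('b \<Rightarrow> 'f)) set set \<Rightarrow> bool" where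
  "order_isomorphic_EP X SX Y SY \<longleftrightarrow> (\<exists>\<phi>. bij_betw \<phi> SX SY \<and>
      (\<forall>A\<in>SX. \<forall>B\<in>SX. EP_le X A B \<longleftrightarrow> EP_le Y (\<phi> A) (\<phi> B)))"

definition stone_cech :: "'a topology \<Rightarrow> 'k topology \<Rightarrow> ('a \<Rightarrow> 'k) \<Rightarrow> bool" where
  "stone_cech X K e \<longleftrightarrow> compact_space K \<and> Hausdorff_space K \<and> embedding_map X K e \<and>
     K closure_of (e ` topspace X) = topspace K \<and>
     (\<forall>f. continuous_map X (top_of_set {0..1::real}) f \<longrightarrow>
        (\<exists>g. continuous_map K (top_of_set {0..1::real}) g \<and> (\<forall>x\<in>topspace X. g (e x) = f x)))"

definition coz :: "'a topology \<Rightarrow> 'a set set" where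
  "coz X = {{x \<in> topspace X. f x \<noteq> 0} | f. continuous_map X (top_of_set {0..1::real}) f}"

definition lambdaP :: "('u topology \<Rightarrow> bool) \<Rightarrow> 'a topology \<Rightarrow> 'k topology \<Rightarrow> ('a \<Rightarrow> 'k) \<Rightarrow> 'k set" where
  "lambdaP P X K e = \<Union>{K interior_of (K closure_of (e ` C)) | C.
      C \<in> coz X \<and> hasP P (subtopology X (X closure_of C))}"

end

theory Submission
  imports Defs
begin

text \<open>Let \<open>S = \<beta>X - \<lambda>X\<close>. An extension \<open>T\<close> of \<open>X\<close> with compact remainder is a perfect image of
  \<open>X \<union> C\<close> for a compact \<open>C \<subseteq> \<beta>X - X\<close>, and \<open>T\<close> has the property iff \<open>S \<subseteq> C\<close>. The fibres on \<open>C\<close> form a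
  closed partial equivalence relation on \<open>\<beta>X - X\<close> containing the diagonal of \<open>S\<close>; every such relation
  arises, and the order of extensions becomes reverse inclusion of relations.

  In this poset the atoms that identify two points of \<open>S\<close> are recognised by order alone, and so are
  the triples of such atoms forming a triangle. An order isomorphism therefore induces a bijection
  between the pairs of points of \<open>S\<close> and of its counterpart that preserves triangles, hence a bijection
  of points. A set \<open>A \<subseteq> S\<close> is closed iff collapsing \<open>A\<close> is a member of the poset, so this bijection
  is a homeomorphism.\<close>

section \<open>Quotients and the property on arbitrary types\<close>

text \<open>\<open>P\<close> speaks of spaces over the single type \<open>'u\<close>, while the
  argument uses subspaces of \<beta>X, products with a two-point space and quotients, all over other
  types. The axioms of \<open>P\<close> become available only after such a space has been copied
  onto \<open>'u\<close>, so injections into \<open>'u\<close> accompany most of the proof. Points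
  of \<beta>X are coded by families of subsets of X; this puts quotients of \<beta>X into
  \<open>'a set set\<close>, the type over which extensions are collected, and the injection from a
  triple power set leaves room for two copies of each. The relations are partial because an
  extension carries two data, the set C and the fibres on it: a symmetric and transitive relation
  remembers C as its domain. Points of C outside S are the obstacle to reading S off the order,
  since adding such a point to the domain is an atom as well. Since X lacks the property, S is
  nonempty; both the recognition of the pair atoms and the argument with condition (W) rest on
  this.\<close>

definition quotient_top :: "'a topology \<Rightarrow> ('a \<Rightarrow> 'b) \<Rightarrow> 'b topology" where
  "quotient_top X q = topology (\<lambda>U. U \<subseteq> q ` topspace X \<and> openin X {x \<in> topspace X. q x \<in> U})"

lemma openin_quotient_top:
  "openin (quotient_top X q) U \<longleftrightarrow> U \<subseteq> q ` topspace X \<and> openin X {x \<in> topspace X. q x \<in> U}"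
proof -
  let ?L = "\<lambda>U. U \<subseteq> q ` topspace X \<and> openin X {x \<in> topspace X. q x \<in> U}"
  have "istopology ?L"
    unfolding istopology_def
  proof (intro conjI allI impI)
    fix S T assume "?L S" "?L T"
    moreover have "{x \<in> topspace X. q x \<in> S \<inter> T} = {x \<in> topspace X. q x \<in> S} \<inter> {x \<in> topspace X. q x \<in> T}"
      by auto
    ultimately show "S \<inter> T \<subseteq> q ` topspace X" "openin X {x \<in> topspace X. q x \<in> S \<inter> T}"
      by auto
  next
    fix F assume F: "\<forall>U\<in>F. ?L U"
    have "{x \<in> topspace X. q x \<in> \<Union>F} = (\<Union>U\<in>F. {x \<in> topspace X. q x \<in> U})"
      by auto
    with F show "openin X {x \<in> topspace X. q x \<in> \<Union>F}" by auto
    show "\<Union>F \<subseteq> q ` topspace X" using F by auto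
  qed
  then show ?thesis
    unfolding quotient_top_def by simp
qed

lemma topspace_quotient_top: "topspace (quotient_top X q) = q ` topspace X"
proof
  have "{x \<in> topspace X. q x \<in> q ` topspace X} = topspace X" by auto
  then have "openin (quotient_top X q) (q ` topspace X)"
    by (simp add: openin_quotient_top)
  then show "q ` topspace X \<subseteq> topspace (quotient_top X q)"
    by (rule openin_subset)
  show "topspace (quotient_top X q) \<subseteq> q ` topspace X"
    using openin_topspace[of "quotient_top X q"] unfolding openin_quotient_top by (rule conjunct1)
qed

lemma quotient_map_quotient_top: "quotient_map X (quotient_top X q) q"
  by (auto simp: quotient_map_def topspace_quotient_top openin_quotient_top)

text \<open>The device for changing types: an injection of the points into \<open>'u\<close> gives a
  copy of the space to which the axioms of the property apply.\<close>

lemma inj_imp_homeomorphic_copy: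
  assumes "inj_on g (topspace X)"
  shows "homeomorphic_map X (quotient_top X g) g"
  using assms quotient_map_quotient_top by (simp add: homeomorphic_map_def)

lemma compact_space_quotient_top:
  "compact_space X \<Longrightarrow> compact_space (quotient_top X q)"
  using image_compactin[of X "topspace X" "quotient_top X q" q]
    quotient_imp_continuous_map[OF quotient_map_quotient_top[of X q]]
  by (simp add: compact_space_def topspace_quotient_top)

text \<open>The saturation of a closed set is the projection of a part of the closed kernel along a
  compact factor. Hence \<open>q\<close> is a closed map, and closed continuous images of normal
  Hausdorff spaces are Hausdorff.\<close>

lemma Hausdorff_space_quotient_top:
  assumes X: "compact_space X" "Hausdorff_space X"
    and clo: "closedin (prod_topology X X) {(x,y) \<in> topspace X \<times> topspace X. q x = q y}"
  shows "Hausdorff_space (quotient_top X q)"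
proof -
  let ?E = "{(x,y) \<in> topspace X \<times> topspace X. q x = q y}"
  have "closedin (quotient_top X q) (q ` A)" if A: "closedin X A" for A
  proof -
    have AX: "A \<subseteq> topspace X" using A closedin_subset by blast
    have "closedin (prod_topology X X) (?E \<inter> A \<times> topspace X)"
      using A clo by (intro closedin_Int) (auto simp: closedin_prod_Times_iff)
    moreover have "closed_map (prod_topology X X) X snd"
      using X(1) by (simp add: closed_map_snd)
    ultimately have "closedin X (snd ` (?E \<inter> A \<times> topspace X))"
      unfolding closed_map_def by blast
    moreover have "snd ` (?E \<inter> A \<times> topspace X) = {x \<in> topspace X. q x \<in> q ` A}"
    proof (intro set_eqI iffI)
      fix y assume "y \<in> {x \<in> topspace X. q x \<in> q ` A}"
      then obtain a where a: "y \<in> topspace X" "a \<in> A" "q y = q a" by auto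
      then have "(a, y) \<in> ?E \<inter> A \<times> topspace X" using AX by auto
      then show "y \<in> snd ` (?E \<inter> A \<times> topspace X)" by (rule image_eqI[rotated]) simp
    qed (auto intro: image_eqI[OF sym])
    ultimately have "closedin X {x \<in> topspace X. q x \<in> q ` A}" by simp
    moreover have "q ` A \<subseteq> topspace (quotient_top X q)"
      using AX by (auto simp: topspace_quotient_top)
    ultimately show ?thesis
      using quotient_map_quotient_top[of X q] unfolding quotient_map_closedin by blast
  qed
  then have "closed_map X (quotient_top X q) q"
    by (simp add: closed_map_def)
  moreover have "normal_space X"
    using X compact_Hausdorff_or_regular_imp_normal_space by blast
  ultimately show ?thesis
    using normal_Hausdorff_space_closed_continuous_map_image[of X "quotient_top X q" q] X(2)
      quotient_imp_continuous_map[OF quotient_map_quotient_top[of X q]] topspace_quotient_top[of X q] by blast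
qed

section \<open>Transfer of the axioms between types\<close>

lemma tych_homeomorphic:
  "X homeomorphic_space Y \<Longrightarrow> tych X \<longleftrightarrow> tych Y"
  unfolding tych_def using homeomorphic_Hausdorff_space homeomorphic_completely_regular_space by blast

lemma tych_subtopology: "tych X \<Longrightarrow> tych (subtopology X S)"
  unfolding tych_def by (simp add: Hausdorff_space_subtopology completely_regular_space_subtopology)

lemma tych_prod_topology: "tych X \<Longrightarrow> tych Y \<Longrightarrow> tych (prod_topology X Y)"
  unfolding tych_def by (simp add: Hausdorff_space_prod_topology completely_regular_space_prod_topology)

lemma tych_compact_Hausdorff:
  assumes "compact_space X" "Hausdorff_space X"
  shows "tych X"
proof -
  have "normal_space X"
    using assms compact_Hausdorff_or_regular_imp_normal_space by blast
  then show ?thesis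
    unfolding tych_def using assms(2) normal_imp_completely_regular_space_A Hausdorff_imp_t1_space by blast
qed

lemma hasP_homeomorphic:
  assumes "S homeomorphic_space T"
  shows "hasP P S \<longleftrightarrow> hasP P T"
  unfolding hasP_def
  using homeomorphic_space_trans[OF assms] homeomorphic_space_trans[OF homeomorphic_space_sym[THEN iffD1, OF assms]]
  by blast

lemma compactness_likeD:
  assumes "compactness_like P"
  shows compactness_like_clopen:
      "\<lbrakk>tych Z; P Z; closedin Z A; openin Z A\<rbrakk> \<Longrightarrow> P (subtopology Z A)"
    and compactness_like_additive:
      "\<lbrakk>tych Z; finite F; F \<noteq> {}; pairwise disjnt F; \<Union>F = topspace Z;
        \<And>A. A \<in> F \<Longrightarrow> closedin Z A \<and> P (subtopology Z A)\<rbrakk> \<Longrightarrow> P Z"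
    and compactness_like_perfect:
      "\<lbrakk>tych Z; tych W; perfect_map Z W f\<rbrakk> \<Longrightarrow> P Z \<longleftrightarrow> P W"
    and compactness_like_W:
      "\<lbrakk>tych Z; p \<in> topspace Z; \<And>V. V \<in> B \<Longrightarrow> openin Z V \<and> p \<in> V;
        \<And>U. openin Z U \<Longrightarrow> p \<in> U \<Longrightarrow> \<exists>V\<in>B. V \<subseteq> U;
        \<And>V. V \<in> B \<Longrightarrow> P (subtopology Z (topspace Z - V))\<rbrakk> \<Longrightarrow> P Z"
proof -
  note c = assms[unfolded compactness_like_def]
  note c1 = c[THEN conjunct1] and c2 = c[THEN conjunct2, THEN conjunct1]
    and c3 = c[THEN conjunct2, THEN conjunct2, THEN conjunct1]
    and c4 = c[THEN conjunct2, THEN conjunct2, THEN conjunct2]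
  show "\<lbrakk>tych Z; P Z; closedin Z A; openin Z A\<rbrakk> \<Longrightarrow> P (subtopology Z A)"
    using c1[THEN spec, THEN spec, of Z A] by blast
  show "\<lbrakk>tych Z; finite F; F \<noteq> {}; pairwise disjnt F; \<Union>F = topspace Z;
        \<And>A. A \<in> F \<Longrightarrow> closedin Z A \<and> P (subtopology Z A)\<rbrakk> \<Longrightarrow> P Z"
    using c2[THEN spec, THEN spec, of Z F] by blast
  show "\<lbrakk>tych Z; tych W; perfect_map Z W f\<rbrakk> \<Longrightarrow> P Z \<longleftrightarrow> P W"
    using c3[THEN spec, THEN spec, THEN spec, of Z W f] by blast
  show "\<lbrakk>tych Z; p \<in> topspace Z; \<And>V. V \<in> B \<Longrightarrow> openin Z V \<and> p \<in> V;
        \<And>U. openin Z U \<Longrightarrow> p \<in> U \<Longrightarrow> \<exists>V\<in>B. V \<subseteq> U;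
        \<And>V. V \<in> B \<Longrightarrow> P (subtopology Z (topspace Z - V))\<rbrakk> \<Longrightarrow> P Z"
    using c4[THEN spec, THEN spec, THEN spec, of Z p B] by blast
qed

text \<open>A homeomorphism is a perfect surjection, so perfect invariance makes the property
  independent of the copy chosen on \<open>'u\<close>.\<close>

lemma hasP_iff_P:
  assumes "compactness_like P" and "tych U"
  shows "hasP P U \<longleftrightarrow> P U"
proof
  assume "hasP P U"
  then obtain W f where W: "P W" "homeomorphic_map U W f"
    unfolding hasP_def homeomorphic_space by blast
  then have "tych W" using assms(2) tych_homeomorphic homeomorphic_map_imp_homeomorphic_space by blast
  then show "P U"
    using W assms homeomorphic_imp_perfect_map[OF W(2)] compactness_like_perfect by metis
qed (auto simp: hasP_def)

lemma hasP_imp_homeomorphic_P: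
  assumes "compactness_like P" "tych Z" "hasP P Z"
  obtains U f where "P U" "tych U" "homeomorphic_map Z U f"
proof -
  obtain U f where U: "P U" "homeomorphic_map Z U f"
    using assms(3) unfolding hasP_def homeomorphic_space by blast
  then have "tych U"
    using assms(2) tych_homeomorphic homeomorphic_map_imp_homeomorphic_space by blast
  then show thesis using that U by blast
qed

lemma homeomorphic_map_restrict:
  assumes "homeomorphic_map X Y f" "S \<subseteq> topspace X"
  shows "subtopology X S homeomorphic_space subtopology Y (f ` S)"
proof -
  have "f ` (topspace X \<inter> S) = topspace Y \<inter> f ` S"
    using assms(2) homeomorphic_imp_surjective_map[OF assms(1)] by blast
  then show ?thesis
    by (rule homeomorphic_map_imp_homeomorphic_space[OF homeomorphic_map_subtopologies[OF assms(1)]])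
qed

lemma homeomorphic_closedin:
  "homeomorphic_map X Y f \<Longrightarrow> closedin X A \<Longrightarrow> closedin Y (f ` A)"
  using homeomorphic_imp_closed_map unfolding closed_map_def by blast

lemma homeomorphic_openin:
  "homeomorphic_map X Y f \<Longrightarrow> openin X A \<Longrightarrow> openin Y (f ` A)"
  using homeomorphic_imp_open_map unfolding open_map_def by blast

lemma hasP_clopen:
  assumes P: "compactness_like P" and Z: "tych Z" "hasP P Z" and A: "closedin Z A" "openin Z A"
  shows "hasP P (subtopology Z A)"
proof -
  obtain U f where U: "P U" "tych U" "homeomorphic_map Z U f"
    using hasP_imp_homeomorphic_P[OF P Z] .
  have "P (subtopology U (f ` A))"
    using U(2,1) homeomorphic_closedin[OF U(3) A(1)] homeomorphic_openin[OF U(3) A(2)]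
    by (rule compactness_like_clopen[OF P])
  then show ?thesis
    using homeomorphic_map_restrict[OF U(3) closedin_subset[OF A(1)]] unfolding hasP_def by blast
qed

text \<open>\<open>hasP\<close> supplies a copy on \<open>'u\<close> only for the space known to
  have the property. The injections supply one for each side, and \<open>f\<close> is conjugated to
  a perfect map between these copies.\<close>

lemma hasP_perfect:
  fixes P :: "'u topology \<Rightarrow> bool" and g :: "'z \<Rightarrow> 'u" and g' :: "'w \<Rightarrow> 'u"
  assumes P: "compactness_like P" and g: "inj_on g (topspace Z)" and g': "inj_on g' (topspace W)"
    and ZW: "tych Z" "tych W" "perfect_map Z W f"
  shows "hasP P Z \<longleftrightarrow> hasP P W"
proof -
  define Z' W' where "Z' = quotient_top Z g" and "W' = quotient_top W g'"
  have hZ: "homeomorphic_map Z Z' g" and hW: "homeomorphic_map W W' g'"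
    using g g' by (simp_all add: inj_imp_homeomorphic_copy Z'_def W'_def)
  obtain k where k: "homeomorphic_map Z' Z k"
    using hZ homeomorphic_map_imp_homeomorphic_space homeomorphic_space homeomorphic_space_sym by blast
  have "perfect_map Z' W' (g' \<circ> (f \<circ> k))"
    by (meson ZW(3) hW homeomorphic_imp_perfect_map k perfect_map_compose)
  moreover have ty: "tych Z'" "tych W'"
    using ZW tych_homeomorphic[OF homeomorphic_map_imp_homeomorphic_space[OF hZ]]
      tych_homeomorphic[OF homeomorphic_map_imp_homeomorphic_space[OF hW]] by blast+
  ultimately have "P Z' \<longleftrightarrow> P W'"
    using compactness_like_perfect[OF P] by metis
  then have "hasP P Z' \<longleftrightarrow> hasP P W'" using hasP_iff_P[OF P] ty by blast
  then show ?thesis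
    using hasP_homeomorphic[OF homeomorphic_map_imp_homeomorphic_space[OF hZ]]
      hasP_homeomorphic[OF homeomorphic_map_imp_homeomorphic_space[OF hW]] by blast
qed

lemma hasP_additive:
  fixes P :: "'u topology \<Rightarrow> bool" and g :: "'z \<Rightarrow> 'u"
  assumes P: "compactness_like P" and g: "inj_on g (topspace Z)" and Z: "tych Z"
    and AB: "closedin Z A" "closedin Z B" "disjnt A B" "A \<union> B = topspace Z"
    and hP: "hasP P (subtopology Z A)" "hasP P (subtopology Z B)"
  shows "hasP P Z"
proof -
  define Z' where "Z' = quotient_top Z g"
  have hZ: "homeomorphic_map Z Z' g"
    using g by (simp add: inj_imp_homeomorphic_copy Z'_def)
  have ty: "tych Z'"
    using Z tych_homeomorphic[OF homeomorphic_map_imp_homeomorphic_space[OF hZ]] by blast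
  have "closedin Z' (g ` D) \<and> P (subtopology Z' (g ` D))"
    if D: "closedin Z D" "hasP P (subtopology Z D)" for D
    using homeomorphic_closedin[OF hZ D(1)] D(2)
      hasP_homeomorphic[OF homeomorphic_map_restrict[OF hZ closedin_subset[OF D(1)]]]
      hasP_iff_P[OF P tych_subtopology[OF ty]] by blast
  then have "\<And>D. D \<in> {g ` A, g ` B} \<Longrightarrow> closedin Z' D \<and> P (subtopology Z' D)"
    using AB hP by blast
  moreover have "pairwise disjnt {g ` A, g ` B}"
    using AB g closedin_subset unfolding pairwise_def disjnt_def inj_on_def by blast
  moreover have "\<Union>{g ` A, g ` B} = topspace Z'"
    using AB(4) by (simp add: Z'_def topspace_quotient_top flip: image_Un)
  ultimately have "P Z'"
    by (intro compactness_like_additive[OF P ty, of "{g ` A, g ` B}"]) simp_all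
  then show ?thesis
    using homeomorphic_map_imp_homeomorphic_space[OF hZ] unfolding hasP_def by blast
qed

lemma hasP_W:
  fixes P :: "'u topology \<Rightarrow> bool" and g :: "'z \<Rightarrow> 'u"
  assumes P: "compactness_like P" and g: "inj_on g (topspace Z)" and Z: "tych Z" and p: "p \<in> topspace Z"
    and V: "\<And>V. openin Z V \<Longrightarrow> p \<in> V \<Longrightarrow> hasP P (subtopology Z (topspace Z - V))"
  shows "hasP P Z"
proof -
  define Z' where "Z' = quotient_top Z g"
  have hZ: "homeomorphic_map Z Z' g"
    using g by (simp add: inj_imp_homeomorphic_copy Z'_def)
  have ty: "tych Z'"
    using Z tych_homeomorphic[OF homeomorphic_map_imp_homeomorphic_space[OF hZ]] by blast
  have tZ: "topspace Z' = g ` topspace Z" by (simp add: Z'_def topspace_quotient_top)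
  have "P (subtopology Z' (topspace Z' - V))" if "openin Z' V" "g p \<in> V" for V
  proof -
    let ?V = "{x \<in> topspace Z. g x \<in> V}"
    have "openin Z ?V" using that hZ homeomorphic_imp_continuous_map openin_continuous_map_preimage by blast
    then have "hasP P (subtopology Z (topspace Z - ?V))"
      using V p that by blast
    moreover have "g ` (topspace Z - ?V) = topspace Z' - V" using tZ by auto
    ultimately show ?thesis
      using hasP_homeomorphic[OF homeomorphic_map_restrict[OF hZ, of "topspace Z - ?V"], of P]
        hasP_iff_P[OF P tych_subtopology[OF ty]] by auto
  qed
  moreover have "g p \<in> topspace Z'" using p tZ by auto
  ultimately have "P Z'"
    by (intro compactness_like_W[OF P ty, of "g p" "{V. openin Z' V \<and> g p \<in> V}"]) auto
  then show ?thesis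
    using homeomorphic_map_imp_homeomorphic_space[OF hZ] unfolding hasP_def by blast
qed

section \<open>Closed subspaces and unions of two closed subspaces\<close>

lemma perfect_map_two_copies:
  assumes AB: "closedin Z A" "closedin Z B"
  shows "perfect_map (subtopology (prod_topology Z (discrete_topology UNIV)) (A \<times> {False} \<union> B \<times> {True}))
           (subtopology Z (A \<union> B)) fst" (is "perfect_map ?W ?Z fst")
proof -
  let ?D = "discrete_topology (UNIV::bool set)"
  have sub: "A \<subseteq> topspace Z" "B \<subseteq> topspace Z" using AB closedin_subset by blast+
  have tW: "topspace ?W = A \<times> {False} \<union> B \<times> {True}" using sub by auto
  have im: "fst ` topspace ?W = A \<union> B" unfolding tW by (simp add: image_Un)
  have clW: "closedin (prod_topology Z ?D) (A \<times> {False} \<union> B \<times> {True})"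
    using AB by (intro closedin_Un) (auto simp: closedin_prod_Times_iff)
  \<comment> \<open>The projection along a compact factor is closed; this factor has two points, so
    the fibres are finite as well.\<close>
  have "compact_space ?D" by (simp add: compact_space_discrete_topology)
  then have "closed_map (prod_topology Z ?D) Z fst"
    by (rule closed_map_fst)
  then have "closed_map ?W Z fst"
    using clW closed_map_from_subtopology by blast
  then have "closed_map ?W ?Z fst"
    using im by (intro closed_map_into_subtopology) auto
  moreover have "compactin ?W {x \<in> topspace ?W. fst x = y}" for y
  proof (rule finite_imp_compactin)
    show "finite {x \<in> topspace ?W. fst x = y}"
      by (rule finite_subset[of _ "{y} \<times> UNIV"]) auto
  qed auto
  moreover have "continuous_map ?W ?Z fst"
    using im by (auto simp: continuous_map_in_subtopology continuous_map_from_subtopology continuous_map_fst)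
  moreover have "topspace ?Z = A \<union> B" using sub by auto
  ultimately show ?thesis
    using im unfolding perfect_map_def proper_map_def by auto
qed

lemma homeomorphic_copy:
  assumes "A \<subseteq> topspace Z"
  shows "subtopology (prod_topology Z (discrete_topology UNIV)) (A \<times> {b}) homeomorphic_space subtopology Z A"
proof -
  have "homeomorphic_maps (subtopology (prod_topology Z (discrete_topology UNIV)) (A \<times> {b})) (subtopology Z A)
          fst (\<lambda>a. (a, b))"
    using assms unfolding homeomorphic_maps_def
    by (auto simp: continuous_map_in_subtopology continuous_map_from_subtopology continuous_map_fst
        continuous_map_pairwise o_def)
  then show ?thesis unfolding homeomorphic_space_def by blast
qed

text \<open>Closed subspaces and non-disjoint finite unions are reached through the perfect projection
  of two disjoint copies \<open>A \<times> {False} \<union> B \<times> {True}\<close> onto \<open>A \<union> B\<close>.\<close>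

lemma hasP_two_copies:
  fixes P :: "'u topology \<Rightarrow> bool" and g :: "'z \<times> bool \<Rightarrow> 'u"
  assumes P: "compactness_like P" and g: "inj_on g (topspace Z \<times> UNIV)" and Z: "tych Z"
    and AB: "closedin Z A" "closedin Z B"
  shows "hasP P (subtopology (prod_topology Z (discrete_topology UNIV)) (A \<times> {False} \<union> B \<times> {True}))
     \<longleftrightarrow> hasP P (subtopology Z (A \<union> B))" (is "hasP P ?W \<longleftrightarrow> _")
proof (rule hasP_perfect[OF P])
  have sub: "A \<subseteq> topspace Z" "B \<subseteq> topspace Z" using AB closedin_subset by blast+
  show "inj_on g (topspace ?W)"
    by (rule inj_on_subset[OF g]) auto
  show "inj_on (\<lambda>z. g (z, True)) (topspace (subtopology Z (A \<union> B)))"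
    using g by (auto simp: inj_on_def)
  show "tych ?W"
    by (intro tych_subtopology tych_prod_topology Z)
       (simp add: tych_def completely_regular_space_discrete_topology)
  show "tych (subtopology Z (A \<union> B))" by (intro tych_subtopology Z)
  show "perfect_map ?W (subtopology Z (A \<union> B)) fst"
    using perfect_map_two_copies[OF AB] .
qed

lemma closedin_two_copies:
  assumes AB: "closedin Z A" "closedin Z B"
  defines "W \<equiv> subtopology (prod_topology Z (discrete_topology UNIV)) (A \<times> {False} \<union> B \<times> {True})"
  shows "closedin W (A \<times> {False})" "closedin W (B \<times> {True})"
    "topspace W = A \<times> {False} \<union> B \<times> {True}"
proof -
  have sub: "A \<subseteq> topspace Z" "B \<subseteq> topspace Z" using AB closedin_subset by blast+
  show "closedin W (A \<times> {False})" "closedin W (B \<times> {True})"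
    unfolding W_def using AB by (auto intro!: closedin_subset_topspace simp: closedin_prod_Times_iff)
  show "topspace W = A \<times> {False} \<union> B \<times> {True}" unfolding W_def using sub by auto
qed

lemma hasP_closed_Un:
  fixes P :: "'u topology \<Rightarrow> bool" and g :: "'z \<times> bool \<Rightarrow> 'u"
  assumes P: "compactness_like P" and g: "inj_on g (topspace Z \<times> UNIV)" and Z: "tych Z"
    and AB: "closedin Z A" "closedin Z B"
    and hP: "hasP P (subtopology Z A)" "hasP P (subtopology Z B)"
  shows "hasP P (subtopology Z (A \<union> B))"
proof -
  let ?D = "prod_topology Z (discrete_topology (UNIV::bool set))"
  define W where "W = subtopology ?D (A \<times> {False} \<union> B \<times> {True})"
  note W = closedin_two_copies[OF AB, folded W_def]
  have sub: "A \<subseteq> topspace Z" "B \<subseteq> topspace Z" using AB closedin_subset by blast+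
  have "hasP P W"
  proof (rule hasP_additive[OF P _ _ W(1,2)])
    show "inj_on g (topspace W)"
      by (rule inj_on_subset[OF g]) (use W(3) sub in auto)
    show "tych W" unfolding W_def
      by (intro tych_subtopology tych_prod_topology Z)
         (simp add: tych_def completely_regular_space_discrete_topology)
    have "subtopology W (A \<times> {False}) = subtopology ?D (A \<times> {False})"
      "subtopology W (B \<times> {True}) = subtopology ?D (B \<times> {True})"
      unfolding W_def subtopology_subtopology by (simp_all add: Int_absorb1)
    then show "hasP P (subtopology W (A \<times> {False}))" "hasP P (subtopology W (B \<times> {True}))"
      using hP hasP_homeomorphic[OF homeomorphic_copy[OF sub(1)], of P]
        hasP_homeomorphic[OF homeomorphic_copy[OF sub(2)], of P]
      by simp_all
  qed (use W(3) in \<open>auto simp: disjnt_def\<close>)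
  then show ?thesis
    using hasP_two_copies[OF P g Z AB] unfolding W_def by blast
qed

text \<open>The disjoint sum of \<open>Z\<close> and \<open>A\<close> maps perfectly onto
  \<open>Z\<close>, so it has the property, and in it the copy of \<open>A\<close> is clopen.
  Inverse invariance thus upgrades heredity from clopen to closed subspaces.\<close>

lemma hasP_closed:
  fixes P :: "'u topology \<Rightarrow> bool" and g :: "'z \<times> bool \<Rightarrow> 'u"
  assumes P: "compactness_like P" and g: "inj_on g (topspace Z \<times> UNIV)" and Z: "tych Z"
    and A: "closedin Z A" and hP: "hasP P Z"
  shows "hasP P (subtopology Z A)"
proof -
  let ?D = "prod_topology Z (discrete_topology (UNIV::bool set))"
  define W where "W = subtopology ?D (topspace Z \<times> {False} \<union> A \<times> {True})"
  note W = closedin_two_copies[OF closedin_topspace A, folded W_def]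
  have sub: "A \<subseteq> topspace Z" using A closedin_subset by blast
  have "hasP P W"
    using hasP_two_copies[OF P g Z closedin_topspace A] hP sub unfolding W_def
    by (simp add: Un_absorb2)
  moreover have "tych W" unfolding W_def
      by (intro tych_subtopology tych_prod_topology Z)
         (simp add: tych_def completely_regular_space_discrete_topology)
  moreover have "openin W (A \<times> {True})"
  proof -
    have "topspace W - topspace Z \<times> {False} = A \<times> {True}" using W(3) by auto
    then show ?thesis using W(1) by (metis openin_diff openin_topspace)
  qed
  ultimately have "hasP P (subtopology W (A \<times> {True}))"
    using hasP_clopen[OF P] W(2) by blast
  moreover have "subtopology W (A \<times> {True}) = subtopology ?D (A \<times> {True})"
    unfolding W_def subtopology_subtopology by (simp add: Int_absorb1)
  ultimately show ?thesis
    using hasP_homeomorphic[OF homeomorphic_copy[OF sub, of True], of P] by simp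
qed

section \<open>The poset of closed partial equivalence relations\<close>

text \<open>The bottom element is described by comparison with all members instead of being named,
  which makes invariance under order isomorphisms immediate.\<close>

definition order_atom :: "'s set set \<Rightarrow> 's set \<Rightarrow> bool" where
  "order_atom R a \<longleftrightarrow> a \<in> R \<and> \<not> (\<forall>r\<in>R. a \<subseteq> r) \<and>
     (\<forall>r\<in>R. r \<subseteq> a \<longrightarrow> r = a \<or> (\<forall>r'\<in>R. r \<subseteq> r'))"

text \<open>In the poset of closed partial equivalence relations containing \<open>Id_on S\<close>, the atoms either
  identify two points of \<open>S\<close> or add one point \<open>p\<close> outside \<open>S\<close> to the domain. The latter are those
  with a strictly larger element above no other atom, namely one that glues \<open>p\<close> to a point of \<open>S\<close>.\<close>

definition pair_atom :: "'s set set \<Rightarrow> 's set \<Rightarrow> bool" where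
  "pair_atom R a \<longleftrightarrow> order_atom R a \<and>
     \<not> (\<exists>r\<in>R. a \<subseteq> r \<and> a \<noteq> r \<and> (\<forall>b\<in>R. order_atom R b \<and> b \<subseteq> r \<longrightarrow> b = a))"

lemma order_atom_iso:
  assumes bij: "bij_betw \<Phi> R R'" and ord: "\<And>a b. a \<in> R \<Longrightarrow> b \<in> R \<Longrightarrow> \<Phi> a \<subseteq> \<Phi> b \<longleftrightarrow> a \<subseteq> b"
    and a: "a \<in> R"
  shows "order_atom R' (\<Phi> a) \<longleftrightarrow> order_atom R a"
proof -
  have R': "R' = \<Phi> ` R" using bij by (auto simp: bij_betw_def)
  have eq: "\<Phi> r = \<Phi> s \<longleftrightarrow> r = s" if "r \<in> R" "s \<in> R" for r s
    using bij that by (auto simp: bij_betw_def inj_on_eq_iff)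
  show ?thesis
    unfolding order_atom_def R' using a by (auto simp: ord eq)
qed

lemma pair_atom_iso:
  assumes bij: "bij_betw \<Phi> R R'" and ord: "\<And>a b. a \<in> R \<Longrightarrow> b \<in> R \<Longrightarrow> \<Phi> a \<subseteq> \<Phi> b \<longleftrightarrow> a \<subseteq> b"
    and a: "a \<in> R"
  shows "pair_atom R' (\<Phi> a) \<longleftrightarrow> pair_atom R a"
proof -
  have R': "R' = \<Phi> ` R" using bij by (auto simp: bij_betw_def)
  have eq: "\<Phi> r = \<Phi> s \<longleftrightarrow> r = s" if "r \<in> R" "s \<in> R" for r s
    using bij that by (auto simp: bij_betw_def inj_on_eq_iff)
  have at: "order_atom (\<Phi> ` R) (\<Phi> r) \<longleftrightarrow> order_atom R r" if "r \<in> R" for r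
    using order_atom_iso[OF bij ord that] R' by simp
  show ?thesis
    unfolding pair_atom_def R' using a
    by (simp add: ord eq at)
qed

text \<open>Reflexivity is required on \<open>S\<close> only, so the domain varies with
  \<open>r\<close>. For a space X, \<open>N\<close> is the remainder of \<beta>X and the domain is
  the part of it that is mapped to the remainder of the extension.\<close>

definition closed_pers :: "'k topology \<Rightarrow> 'k set \<Rightarrow> 'k set \<Rightarrow> ('k \<times> 'k) set set" where
  "closed_pers K N S = {r. closedin (prod_topology K K) r \<and> r \<subseteq> N \<times> N \<and> sym r \<and> trans r \<and> Id_on S \<subseteq> r}"

text \<open>Collapses \<open>A\<close> to one class. A singleton outside \<open>S\<close> is merely
  added to the domain.\<close>

definition blk :: "'k set \<Rightarrow> 'k set \<Rightarrow> ('k \<times> 'k) set" where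
  "blk S A = Id_on S \<union> A \<times> A"

section \<open>Recovering points from pairs and triangles\<close>

definition pairs :: "'k set \<Rightarrow> 'k set set" where
  "pairs S = {{s, t} | s t. s \<in> S \<and> t \<in> S \<and> s \<noteq> t}"

definition triangle :: "'k set \<Rightarrow> 'k set \<Rightarrow> 'k set \<Rightarrow> bool" where
  "triangle A B C \<longleftrightarrow> (\<exists>p q r. p \<noteq> q \<and> p \<noteq> r \<and> q \<noteq> r \<and> A = {p, q} \<and> B = {p, r} \<and> C = {q, r})"

lemma doubleton_in_pairs: "{x, y} \<in> pairs S \<longleftrightarrow> x \<in> S \<and> y \<in> S \<and> x \<noteq> y"
  by (auto simp: pairs_def doubleton_eq_iff)

lemma pairsE:
  assumes "A \<in> pairs S"
  obtains s t where "s \<in> S" "t \<in> S" "s \<noteq> t" "A = {s, t}"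
  using assms unfolding pairs_def by blast

text \<open>Three pairwise intersecting pairs form a triangle or a star; as triangles are preserved,
  the images of the pairs through \<open>x\<close> form a star, whose centre is the image of \<open>x\<close>.\<close>

lemma pairs_bij_induced:
  assumes F: "bij_betw F (pairs S) (pairs T)"
    and tri: "\<And>A B C. A \<in> pairs S \<Longrightarrow> B \<in> pairs S \<Longrightarrow> C \<in> pairs S \<Longrightarrow> triangle A B C
                \<Longrightarrow> triangle (F A) (F B) (F C)"
    and S: "S \<noteq> {}" and T: "T \<noteq> {}"
  obtains h where "bij_betw h S T" "\<And>x y. x \<in> S \<Longrightarrow> y \<in> S \<Longrightarrow> x \<noteq> y \<Longrightarrow> F {x, y} = {h x, h y}"
proof -
  have Fp: "F A \<in> pairs T" if "A \<in> pairs S" for A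
    using F that bij_betwE by blast
  have Finj: "A = B" if "F A = F B" "A \<in> pairs S" "B \<in> pairs S" for A B
    using F that by (auto simp: bij_betw_def inj_on_def)
  have Fsur: "\<exists>A\<in>pairs S. F A = B" if "B \<in> pairs T" for B
    using F that unfolding bij_betw_def by (metis imageE)
  consider (three) x y z where "x \<in> S" "y \<in> S" "z \<in> S" "x \<noteq> y" "x \<noteq> z" "y \<noteq> z"
    | (two) x y where "S = {x, y}" "x \<noteq> y" | (one) x where "S = {x}"
    using S by blast
  then show thesis
  proof cases
    case one
    have "pairs S = {}" by (auto simp: pairs_def one)
    then have "pairs T = {}" using F by (simp add: bij_betw_def)
    then have "\<And>u v. u \<in> T \<Longrightarrow> v \<in> T \<Longrightarrow> u = v" by (metis doubleton_in_pairs empty_iff)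
    then obtain u where "T = {u}" using T by blast
    then show thesis using that[of "\<lambda>_. u"] one by (auto simp: bij_betw_def)
  next
    case two
    have pS: "pairs S = {{x, y}}" unfolding pairs_def two(1) using two(2) by blast
    obtain u v where uv: "F {x, y} = {u, v}" "u \<in> T" "v \<in> T" "u \<noteq> v"
      by (rule pairsE[OF Fp[of "{x, y}"]]) (simp_all add: pS)
    have "w \<in> {u, v}" if "w \<in> T" for w
    proof (rule ccontr)
      assume "w \<notin> {u, v}"
      then have "{u, w} \<in> pairs T" using uv that by (auto simp: doubleton_in_pairs)
      then have "{u, w} = {u, v}" using Fsur[of "{u, w}"] pS uv by simp
      then show False using \<open>w \<notin> {u, v}\<close> by blast
    qed
    then have "T = {u, v}" using uv by blast
    \<comment> \<open>Both bijections between two-point sets induce \<open>F\<close>; either may be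
      taken.\<close>
    then have "bij_betw (\<lambda>z. if z = x then u else v) S T"
      using two uv by (auto simp: bij_betw_def inj_on_def)
    then show thesis
    proof (rule that[of "\<lambda>z. if z = x then u else v"])
      fix a b assume "a \<in> S" "b \<in> S" "a \<noteq> b"
      then consider "a = x" "b = y" | "a = y" "b = x" using two by blast
      then show "F {a, b} = {if a = x then u else v, if b = x then u else v}"
        using two(2) uv(1) by cases (simp_all add: insert_commute)
    qed
  next
    case three
    have two_others: "\<exists>b\<in>S. \<exists>c\<in>S. b \<noteq> a \<and> c \<noteq> a \<and> b \<noteq> c" for a
      using three by metis
    have tri': "triangle (F {a, b}) (F {a, c}) (F {b, c})"
      if "a \<in> S" "b \<in> S" "c \<in> S" "a \<noteq> b" "a \<noteq> c" "b \<noteq> c" for a b c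
      using that by (intro tri) (auto simp: doubleton_in_pairs triangle_def)
    have "\<exists>a'. \<forall>w\<in>S. w \<noteq> a \<longrightarrow> a' \<in> F {a, w}" if a: "a \<in> S" for a
    proof -
      obtain b c where bc: "b \<in> S" "c \<in> S" "b \<noteq> a" "c \<noteq> a" "b \<noteq> c" using two_others by metis
      then obtain p q r where pqr: "p \<noteq> q" "p \<noteq> r" "q \<noteq> r" "F {a, b} = {p, q}" "F {a, c} = {p, r}" "F {b, c} = {q, r}"
        using tri'[of a b c] a unfolding triangle_def by blast
      \<comment> \<open>\<open>p\<close> is the common point of the images of two pairs through
        \<open>a\<close>. A pair meeting both images but avoiding \<open>p\<close> is
        \<open>{q, r}\<close>, the image of \<open>{b, c}\<close>, which injectivity of
        \<open>F\<close> forbids for \<open>{a, w}\<close>.\<close>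
      have "p \<in> F {a, w}" if w: "w \<in> S" "w \<noteq> a" for w
      proof (rule ccontr)
        assume np: "p \<notin> F {a, w}"
        then have wbc: "w \<noteq> b" "w \<noteq> c" using pqr by auto
        have "triangle (F {a, b}) (F {a, w}) (F {b, w})" "triangle (F {a, c}) (F {a, w}) (F {c, w})"
          using tri' a bc w wbc by metis+
        then have "{p, q} \<inter> F {a, w} \<noteq> {}" "{p, r} \<inter> F {a, w} \<noteq> {}"
          using pqr unfolding triangle_def by auto
        then have "q \<in> F {a, w}" "r \<in> F {a, w}" using np by auto
        moreover have "{a, w} \<in> pairs S" using a w by (simp add: doubleton_in_pairs)
        then have "F {a, w} \<in> pairs T" by (rule Fp)
        ultimately have "F {a, w} = F {b, c}" using pqr unfolding pairs_def by auto
        then have "{a, w} = {b, c}" using Finj a w bc by (simp add: doubleton_in_pairs)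
        then show False using bc by auto
      qed
      then show ?thesis by blast
    qed
    then obtain h where h: "\<And>a w. a \<in> S \<Longrightarrow> w \<in> S \<Longrightarrow> w \<noteq> a \<Longrightarrow> h a \<in> F {a, w}" by metis
    \<comment> \<open>A common value of \<open>h\<close> at \<open>a\<close> and \<open>b\<close>
      would lie on all three sides of the image of a triangle.\<close>
    have hne: "h a \<noteq> h b" if ab: "a \<in> S" "b \<in> S" "a \<noteq> b" for a b
    proof
      assume eq: "h a = h b"
      obtain c where c: "c \<in> S" "c \<noteq> a" "c \<noteq> b" using three by metis
      have "h a \<in> F {a, b}" "h a \<in> F {a, c}" "h a \<in> F {b, c}"
        using h[of a b] h[of a c] h[of b c] ab c eq by auto
      moreover have "triangle (F {a, b}) (F {a, c}) (F {b, c})" using tri' ab c by metis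
      ultimately show False unfolding triangle_def by auto
    qed
    have Fh: "F {a, b} = {h a, h b}" if ab: "a \<in> S" "b \<in> S" "a \<noteq> b" for a b
    proof -
      have "h a \<in> F {a, b}" "h b \<in> F {a, b}"
        using h[of a b] h[of b a] ab by (auto simp: insert_commute)
      moreover have "F {a, b} \<in> pairs T" using Fp ab by (simp add: doubleton_in_pairs)
      ultimately show ?thesis using hne[OF ab] unfolding pairs_def by auto
    qed
    have "h ` S = T"
    proof
      show "h ` S \<subseteq> T"
      proof clarify
        fix a assume a: "a \<in> S"
        then obtain b where b: "b \<in> S" "b \<noteq> a" using two_others by metis
        then have "F {a, b} \<in> pairs T" using Fp a by (simp add: doubleton_in_pairs)
        then have "{h a, h b} \<in> pairs T" using Fh a b by simp
        then show "h a \<in> T" by (simp add: doubleton_in_pairs)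
      qed
      show "T \<subseteq> h ` S"
      proof
        fix u assume u: "u \<in> T"
        obtain v where v: "v \<in> T" "v \<noteq> u"
          using hne[OF three(1,2,4)] Fp[of "{x, y}"] Fh[OF three(1,2,4)] three by (metis doubleton_in_pairs)
        then obtain A where "A \<in> pairs S" "F A = {u, v}" using Fsur[of "{u, v}"] u by (auto simp: doubleton_in_pairs)
        then obtain a b where ab: "a \<in> S" "b \<in> S" "a \<noteq> b" "F {a, b} = {u, v}" by (metis pairsE)
        then have "{h a, h b} = {u, v}" using Fh by metis
        then have "u \<in> {h a, h b}" by simp
        then show "u \<in> h ` S" using ab by blast
      qed
    qed
    then have "bij_betw h S T" using hne unfolding bij_betw_def inj_on_def by metis
    then show thesis using that Fh by blast
  qed
qed

section \<open>Atoms and upper bounds in the poset of relations\<close>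

locale pers =
  fixes K :: "'k topology" and N S :: "'k set"
  assumes Hausdorff: "Hausdorff_space K" and closedS: "closedin K S" and SN: "S \<subseteq> N" and NK: "N \<subseteq> topspace K"
    and S_nonempty: "S \<noteq> {}"
begin

abbreviation "R \<equiv> closed_pers K N S"

lemma closed_Id_on: "closedin (prod_topology K K) (Id_on S)"
proof -
  have "closedin (prod_topology K K) ((\<lambda>x. (x, x)) ` topspace K \<inter> S \<times> S)"
    using Hausdorff closedS
    by (intro closedin_Int) (auto simp: closedin_prod_Times_iff Hausdorff_space_closedin_diagonal)
  moreover have "(\<lambda>x. (x, x)) ` topspace K \<inter> S \<times> S = Id_on S"
    using closedS closedin_subset by fastforce
  ultimately show ?thesis by simp
qed

lemma Id_on_in: "Id_on S \<in> R"
  using closed_Id_on SN by (auto simp: closed_pers_def sym_def trans_def)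

lemma blk_in: "closedin K A \<Longrightarrow> A \<subseteq> N \<Longrightarrow> blk S A \<in> R"
  using closed_Id_on SN unfolding closed_pers_def blk_def
  by (auto simp: sym_def trans_def closedin_prod_Times_iff intro!: closedin_Un)

text \<open>Disjointness of the two blocks keeps the union transitive.\<close>

lemma blk2_in:
  "closedin K A \<Longrightarrow> A \<subseteq> N \<Longrightarrow> closedin K B \<Longrightarrow> B \<subseteq> N \<Longrightarrow> A \<inter> B = {} \<Longrightarrow> blk S A \<union> B \<times> B \<in> R"
  using closed_Id_on SN unfolding closed_pers_def blk_def
  by (auto simp: sym_def trans_def closedin_prod_Times_iff intro!: closedin_Un)

lemma finite_closed: "finite A \<Longrightarrow> A \<subseteq> N \<Longrightarrow> closedin K A"
  using Hausdorff NK closedin_Hausdorff_finite by blast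

lemma in_R:
  assumes "r \<in> R"
  shows R_sym: "(x, y) \<in> r \<Longrightarrow> (y, x) \<in> r" and R_trans: "(x, y) \<in> r \<Longrightarrow> (y, z) \<in> r \<Longrightarrow> (x, z) \<in> r"
    and R_N: "(x, y) \<in> r \<Longrightarrow> x \<in> N \<and> y \<in> N" and R_refl: "s \<in> S \<Longrightarrow> (s, s) \<in> r"
    and R_Id: "Id_on S \<subseteq> r"
proof -
  have r: "r \<subseteq> N \<times> N" "sym r" "trans r" "Id_on S \<subseteq> r" using assms by (simp_all add: closed_pers_def)
  show "(x, y) \<in> r \<Longrightarrow> (y, x) \<in> r" using r(2) by (rule symD)
  show "(x, y) \<in> r \<Longrightarrow> (y, z) \<in> r \<Longrightarrow> (x, z) \<in> r" using r(3) by (rule transD)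
  show "(x, y) \<in> r \<Longrightarrow> x \<in> N \<and> y \<in> N" using r(1) by blast
  show "s \<in> S \<Longrightarrow> (s, s) \<in> r" using r(4) by blast
  show "Id_on S \<subseteq> r" by (rule r(4))
qed

text \<open>Symmetry and transitivity put both endpoints into the domain. With \<open>s = t\<close>
  this is the criterion for a point to belong to the domain.\<close>

lemma blk_pair_le:
  assumes "r \<in> R"
  shows "blk S {s, t} \<subseteq> r \<longleftrightarrow> (s, t) \<in> r"
proof
  show "blk S {s, t} \<subseteq> r \<Longrightarrow> (s, t) \<in> r" by (auto simp: blk_def)
  assume st: "(s, t) \<in> r"
  then have ts: "(t, s) \<in> r" by (rule R_sym[OF assms])
  have "(s, s) \<in> r" "(t, t) \<in> r" using R_trans[OF assms st ts] R_trans[OF assms ts st] .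
  then show "blk S {s, t} \<subseteq> r" using st ts R_Id[OF assms] by (auto simp: blk_def)
qed

lemma bottom_iff: "b \<in> R \<Longrightarrow> (\<forall>r\<in>R. b \<subseteq> r) \<longleftrightarrow> b = Id_on S"
  using Id_on_in by (auto dest: R_Id)

lemma order_atom_iff:
  "order_atom R a \<longleftrightarrow> a \<in> R \<and> a \<noteq> Id_on S \<and> (\<forall>r\<in>R. r \<subseteq> a \<longrightarrow> r = a \<or> r = Id_on S)"
  unfolding order_atom_def by (metis bottom_iff)

lemma order_atom_pair:
  assumes "s \<in> S" "t \<in> S" "s \<noteq> t"
  shows "order_atom R (blk S {s, t})"
  unfolding order_atom_iff
proof (intro conjI ballI impI)
  show "blk S {s, t} \<in> R" using assms SN by (intro blk_in finite_closed) auto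
  show "blk S {s, t} \<noteq> Id_on S" using assms by (auto simp: blk_def)
  fix r assume r: "r \<in> R" "r \<subseteq> blk S {s, t}"
  show "r = blk S {s, t} \<or> r = Id_on S"
  proof (cases "(s, t) \<in> r")
    case True
    then show ?thesis using blk_pair_le[OF r(1)] r(2) by blast
  next
    case False
    then have "(t, s) \<notin> r" using R_sym[OF r(1)] by blast
    then show ?thesis using False r(2) R_Id[OF r(1)] assms by (auto simp: blk_def)
  qed
qed

lemma order_atom_point:
  assumes "p \<in> N - S"
  shows "order_atom R (blk S {p})"
  unfolding order_atom_iff
proof (intro conjI ballI impI)
  show "blk S {p} \<in> R" using assms SN by (intro blk_in finite_closed) auto
  show "blk S {p} \<noteq> Id_on S" using assms by (auto simp: blk_def)
  fix r assume r: "r \<in> R" "r \<subseteq> blk S {p}"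
  then show "r = blk S {p} \<or> r = Id_on S" using R_Id[OF r(1)] by (auto simp: blk_def)
qed

text \<open>Every member other than the bottom lies above an atom: an endpoint outside
  \<open>S\<close> already belongs to the domain and gives a point atom, and otherwise two distinct
  points of \<open>S\<close> are identified.\<close>

lemma atom_below:
  assumes r: "r \<in> R" and xy: "(x, y) \<in> r" "(x, y) \<notin> Id_on S"
  obtains p where "p \<in> N - S" "blk S {p} \<subseteq> r" "p \<in> {x, y}"
    | "x \<in> S" "y \<in> S" "x \<noteq> y" "blk S {x, y} \<subseteq> r"
proof -
  have *: "(x, x) \<in> r" "(y, y) \<in> r" "x \<in> N" "y \<in> N"
    using xy R_sym[OF r] R_trans[OF r] R_N[OF r] by blast+
  have **: "blk S {p} \<subseteq> r" if "(p, p) \<in> r" for p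
    using blk_pair_le[OF r, of p p] that by simp
  show thesis
  proof (cases "x \<in> S \<and> y \<in> S")
    case True
    then show thesis using that(2) xy blk_pair_le[OF r] by blast
  next
    case False
    then show thesis using that(1)[of x] that(1)[of y] * ** by blast
  qed
qed

lemma order_atom_cases:
  assumes "order_atom R a"
  obtains s t where "s \<in> S" "t \<in> S" "s \<noteq> t" "a = blk S {s, t}" | p where "p \<in> N - S" "a = blk S {p}"
proof -
  have a: "a \<in> R" "a \<noteq> Id_on S" "\<And>r. r \<in> R \<Longrightarrow> r \<subseteq> a \<Longrightarrow> r = a \<or> r = Id_on S"
    using assms unfolding order_atom_iff by blast+
  have "\<not> a \<subseteq> Id_on S" using R_Id[OF a(1)] a(2) by blast
  then obtain x y where xy: "(x, y) \<in> a" "(x, y) \<notin> Id_on S" by auto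
  show thesis
  proof (rule atom_below[OF a(1) xy])
    fix p assume p: "p \<in> N - S" "blk S {p} \<subseteq> a"
    have "blk S {p} \<in> R" "blk S {p} \<noteq> Id_on S" using order_atom_point[OF p(1)] unfolding order_atom_iff by blast+
    then have "blk S {p} = a" using a(3) p(2) by metis
    then show thesis using that(2) p(1) by metis
  next
    assume p: "x \<in> S" "y \<in> S" "x \<noteq> y" "blk S {x, y} \<subseteq> a"
    have "blk S {x, y} \<in> R" "blk S {x, y} \<noteq> Id_on S"
      using order_atom_pair[OF p(1-3)] unfolding order_atom_iff by blast+
    then have "blk S {x, y} = a" using a(3) p(4) by metis
    then show thesis using that(1) p(1-3) by metis
  qed
qed

lemma pair_atom_iff: "pair_atom R a \<longleftrightarrow> (\<exists>A\<in>pairs S. a = blk S A)"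
proof
  assume a: "pair_atom R a"
  then have "order_atom R a" by (simp add: pair_atom_def)
  then show "\<exists>A\<in>pairs S. a = blk S A"
  proof (cases rule: order_atom_cases)
    case (1 s t)
    then show ?thesis by (intro bexI[of _ "{s, t}"]) (auto simp: doubleton_in_pairs)
  next
    case (2 p)
    \<comment> \<open>Gluing \<open>p\<close> to a single point of \<open>S\<close> identifies no
      two points of \<open>S\<close> and brings in no other new point, so the only atom below is
      that of \<open>p\<close>.\<close>
    obtain s0 where s0: "s0 \<in> S" using S_nonempty by blast
    let ?r = "blk S {p, s0}"
    have "?r \<in> R" using s0 2 SN by (intro blk_in finite_closed) auto
    moreover have "a \<subseteq> ?r" "a \<noteq> ?r" using 2 s0 by (auto simp: blk_def)
    moreover have "b = a" if b: "order_atom R b" "b \<subseteq> ?r" for b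
      using b(1)
    proof (cases rule: order_atom_cases)
      case (1 s t)
      then have "(s, t) \<in> ?r" using b(2) by (auto simp: blk_def)
      then show ?thesis using 1 2 s0 by (auto simp: blk_def)
    next
      case (2 q)
      then have "(q, q) \<in> ?r" using b(2) by (auto simp: blk_def)
      then show ?thesis using \<open>a = blk S {p}\<close> 2 s0 by (auto simp: blk_def)
    qed
    ultimately show ?thesis using a unfolding pair_atom_def by blast
  qed
next
  assume "\<exists>A\<in>pairs S. a = blk S A"
  then obtain s t where st: "s \<in> S" "t \<in> S" "s \<noteq> t" "a = blk S {s, t}" unfolding pairs_def by blast
  \<comment> \<open>Anything in \<open>r\<close> beyond \<open>a\<close> produces an atom below
    \<open>r\<close>: either a point atom, whose point lies outside \<open>S\<close>, or the atom of
    a pair that \<open>a\<close> does not identify.\<close>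
  have "\<exists>b\<in>R. order_atom R b \<and> b \<subseteq> r \<and> b \<noteq> a" if r: "r \<in> R" "a \<subseteq> r" "a \<noteq> r" for r
  proof -
    obtain x y where xy: "(x, y) \<in> r" "(x, y) \<notin> a" using r by auto
    then have "(x, y) \<notin> Id_on S" using st by (auto simp: blk_def)
    from r(1) xy(1) this show ?thesis
    proof (rule atom_below)
      fix p assume p: "p \<in> N - S" "blk S {p} \<subseteq> r"
      then have "(p, p) \<in> blk S {p}" "(p, p) \<notin> a" using st by (auto simp: blk_def)
      then show ?thesis using p order_atom_point[OF p(1)] unfolding order_atom_iff by blast
    next
      assume p: "x \<in> S" "y \<in> S" "x \<noteq> y" "blk S {x, y} \<subseteq> r"
      then have "(x, y) \<in> blk S {x, y}" by (auto simp: blk_def)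
      then show ?thesis using p xy order_atom_pair[OF p(1-3)] unfolding order_atom_iff by blast
    qed
  qed
  then show "pair_atom R a"
    unfolding pair_atom_def using order_atom_pair[OF st(1-3)] st(4) by blast
qed

lemma blk_pairs_in: "A \<in> pairs S \<Longrightarrow> blk S A \<in> R"
  using pair_atom_iff unfolding pair_atom_def order_atom_def by blast

lemma blk_inj: "inj_on (blk S) (pairs S)"
proof (rule inj_onI)
  fix A B assume "A \<in> pairs S" "B \<in> pairs S" and eq: "blk S A = blk S B"
  then obtain s t u v where st: "s \<noteq> t" "A = {s, t}" "u \<noteq> v" "B = {u, v}" unfolding pairs_def by blast
  then have "(s, t) \<in> blk S B" using eq by (auto simp: blk_def)
  then have "s \<in> B" "t \<in> B" using st by (auto simp: blk_def)
  then show "A = B" using st by auto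
qed

lemma triangle_imp_below:
  assumes "triangle A B C" "r \<in> R" "blk S A \<subseteq> r" "blk S B \<subseteq> r"
  shows "blk S C \<subseteq> r"
proof -
  obtain p q s where "A = {p, q}" "B = {p, s}" "C = {q, s}" using assms(1) unfolding triangle_def by blast
  then show ?thesis using assms(2-4) blk_pair_le[OF assms(2)] R_sym[OF assms(2)] R_trans[OF assms(2)] by blast
qed

text \<open>Two disjoint pairs have an upper bound that keeps their blocks apart, so no third pair
  is forced. For pairs with a common point, collapsing the three points involved forces only the
  remaining side. Together with \<open>triangle_imp_below\<close> this expresses triangles by the
  order alone.\<close>

lemma below_imp_triangle:
  assumes ABC: "A \<in> pairs S" "B \<in> pairs S" "C \<in> pairs S" and ne: "A \<noteq> B" "A \<noteq> C" "B \<noteq> C"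
    and below: "\<And>r. r \<in> R \<Longrightarrow> blk S A \<subseteq> r \<Longrightarrow> blk S B \<subseteq> r \<Longrightarrow> blk S C \<subseteq> r"
  shows "triangle A B C"
proof -
  obtain x y where C: "C = {x, y}" "x \<noteq> y" using ABC unfolding pairs_def by blast
  have sub: "A \<subseteq> N" "B \<subseteq> N" "finite A" "finite B" using ABC SN unfolding pairs_def by auto
  show ?thesis
  proof (cases "A \<inter> B = {}")
    case True
    let ?r = "blk S A \<union> B \<times> B"
    have "?r \<in> R" using sub True by (intro blk2_in finite_closed)
    then have "blk S C \<subseteq> ?r" by (rule below) (auto simp: blk_def)
    then have "(x, y) \<in> ?r" using C by (auto simp: blk_def)
    then have "C \<subseteq> A \<or> C \<subseteq> B" using C by (auto simp: blk_def)
    then have "C = A \<or> C = B" using ABC C unfolding pairs_def by auto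
    then show ?thesis using ne by blast
  next
    case False
    then obtain p q s where pqs: "A = {p, q}" "B = {p, s}" "p \<noteq> q" "p \<noteq> s"
      using ABC unfolding pairs_def by (auto simp: insert_commute)
    then have "q \<noteq> s" using ne by auto
    let ?r = "blk S (A \<union> B)"
    have "?r \<in> R" using sub by (intro blk_in finite_closed) auto
    then have "blk S C \<subseteq> ?r" by (rule below) (auto simp: blk_def)
    then have "(x, y) \<in> ?r" using C by (auto simp: blk_def)
    then have "x \<in> {p, q, s}" "y \<in> {p, q, s}" using C pqs by (auto simp: blk_def)
    then have "C = {q, s}" using C pqs ne by (auto simp: insert_commute)
    then show ?thesis using pqs \<open>q \<noteq> s\<close> unfolding triangle_def by blast
  qed
qed

end

section \<open>Recovering the topology\<close>

lemma closed_image_of_iso: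
  assumes "pers K N S" "pers K' N' T"
    and \<Phi>: "\<And>r. r \<in> closed_pers K N S \<Longrightarrow> \<Phi> r \<in> closed_pers K' N' T"
    and h: "bij_betw h S T"
    and key: "\<And>r x y. r \<in> closed_pers K N S \<Longrightarrow> x \<in> S \<Longrightarrow> y \<in> S \<Longrightarrow> (h x, h y) \<in> \<Phi> r \<longleftrightarrow> (x, y) \<in> r"
    and A: "closedin K A" "A \<subseteq> S"
  shows "closedin K' (h ` A)"
proof (cases "A = {}")
  case False
  interpret X: pers K N S by fact
  interpret Y: pers K' N' T by fact
  obtain a where a: "a \<in> A" using False by blast
  let ?E = "blk S A"
  have E: "?E \<in> closed_pers K N S" using A X.SN by (intro X.blk_in) auto
  have hT: "h ` S = T" using h by (simp add: bij_betw_def)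
  have "h a \<in> T" using a A hT by blast
  then have ha: "h a \<in> topspace K'" using Y.SN Y.NK by blast
  have iff: "(h a, h y) \<in> \<Phi> ?E \<longleftrightarrow> y \<in> A" if "y \<in> S" for y
    using key[OF E _ that, of a] a A by (auto simp: blk_def)
  \<comment> \<open>The image of \<open>A\<close> is the class of \<open>h a\<close> in the relation
    corresponding to the collapse of \<open>A\<close>, cut down to \<open>T\<close>; classes of a
    closed relation are closed.\<close>
  have "h ` A = {v \<in> topspace K'. (h a, v) \<in> \<Phi> ?E} \<inter> T"
  proof
    show "h ` A \<subseteq> {v \<in> topspace K'. (h a, v) \<in> \<Phi> ?E} \<inter> T"
      using iff A hT Y.SN Y.NK by blast
    show "{v \<in> topspace K'. (h a, v) \<in> \<Phi> ?E} \<inter> T \<subseteq> h ` A"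
      using iff hT by blast
  qed
  moreover have "closedin K' {v \<in> topspace K'. (h a, v) \<in> \<Phi> ?E}"
  proof (rule closedin_continuous_map_preimage)
    show "continuous_map K' (prod_topology K' K') (\<lambda>v. (h a, v))"
      using ha by (simp add: continuous_map_pairwise o_def)
    show "closedin (prod_topology K' K') (\<Phi> ?E)" using \<Phi>[OF E] by (simp add: closed_pers_def)
  qed
  ultimately show ?thesis using Y.closedS by auto
qed auto

theorem closed_pers_determine_space:
  assumes X: "pers K N S" and Y: "pers K' N' T"
    and bij: "bij_betw \<Phi> (closed_pers K N S) (closed_pers K' N' T)"
    and ord: "\<And>a b. a \<in> closed_pers K N S \<Longrightarrow> b \<in> closed_pers K N S \<Longrightarrow> \<Phi> a \<subseteq> \<Phi> b \<longleftrightarrow> a \<subseteq> b"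
  shows "subtopology K S homeomorphic_space subtopology K' T"
proof -
  interpret X: pers K N S by fact
  interpret Y: pers K' N' T by fact
  have in': "\<And>r. r \<in> X.R \<Longrightarrow> \<Phi> r \<in> Y.R" using bij bij_betwE by blast
  \<comment> \<open>Pair atoms are defined by the order, so \<Phi> matches them, and with them the
    pairs.\<close>
  have "\<exists>B\<in>pairs T. \<Phi> (blk S A) = blk T B" if "A \<in> pairs S" for A
    using pair_atom_iso[OF bij ord X.blk_pairs_in[OF that]] X.pair_atom_iff Y.pair_atom_iff that by blast
  then obtain F where F: "\<And>A. A \<in> pairs S \<Longrightarrow> F A \<in> pairs T" "\<And>A. A \<in> pairs S \<Longrightarrow> \<Phi> (blk S A) = blk T (F A)"
    by metis
  have "inj_on F (pairs S)"
  proof (rule inj_onI)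
    fix A B assume AB: "A \<in> pairs S" "B \<in> pairs S" "F A = F B"
    then have "\<Phi> (blk S A) = \<Phi> (blk S B)" using F by simp
    then have "blk S A = blk S B" using bij AB X.blk_pairs_in by (auto simp: bij_betw_def inj_on_def)
    then show "A = B" using X.blk_inj AB by (auto simp: inj_on_def)
  qed
  moreover have "F ` pairs S = pairs T"
  proof
    show "pairs T \<subseteq> F ` pairs S"
    proof
      fix B assume B: "B \<in> pairs T"
      then obtain r where r: "r \<in> X.R" "\<Phi> r = blk T B"
        using bij Y.blk_pairs_in[OF B] unfolding bij_betw_def by (metis imageE)
      then have "pair_atom X.R r"
        using pair_atom_iso[OF bij ord r(1)] Y.pair_atom_iff B by auto
      then obtain A where A: "A \<in> pairs S" "r = blk S A" using X.pair_atom_iff by blast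
      then have "blk T (F A) = blk T B" using F r by simp
      then have "F A = B" using Y.blk_inj F(1)[OF A(1)] B by (auto simp: inj_on_def)
      then show "B \<in> F ` pairs S" using A by blast
    qed
  qed (use F in blast)
  ultimately have Fbij: "bij_betw F (pairs S) (pairs T)" by (simp add: bij_betw_def)
  \<comment> \<open>The third side lies below every common upper bound of the other two, and all
    upper bounds on the other side are images under \<Phi>.\<close>
  have tri: "triangle (F A) (F B) (F C)" if ABC: "A \<in> pairs S" "B \<in> pairs S" "C \<in> pairs S" and t: "triangle A B C" for A B C
  proof (rule Y.below_imp_triangle)
    have "A \<noteq> B" "A \<noteq> C" "B \<noteq> C" using t unfolding triangle_def by (auto simp: doubleton_eq_iff)
    then show "F A \<noteq> F B" "F A \<noteq> F C" "F B \<noteq> F C"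
      using \<open>inj_on F (pairs S)\<close> ABC by (auto simp: inj_on_eq_iff)
    fix r' assume r': "r' \<in> Y.R" "blk T (F A) \<subseteq> r'" "blk T (F B) \<subseteq> r'"
    then obtain r where r: "r \<in> X.R" "r' = \<Phi> r" using bij unfolding bij_betw_def by blast
    then have "blk S A \<subseteq> r" "blk S B \<subseteq> r"
      using r' F(2) ABC ord X.blk_pairs_in by metis+
    then have "blk S C \<subseteq> r" using X.triangle_imp_below[OF t r(1)] by blast
    then show "blk T (F C) \<subseteq> r'" using r F(2) ABC ord X.blk_pairs_in by metis
  qed (use F ABC in auto)
  obtain h where h: "bij_betw h S T" "\<And>x y. x \<in> S \<Longrightarrow> y \<in> S \<Longrightarrow> x \<noteq> y \<Longrightarrow> F {x, y} = {h x, h y}"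
    using pairs_bij_induced[OF Fbij tri X.S_nonempty Y.S_nonempty] by blast
  have hS: "h x \<in> T" if "x \<in> S" for x using h(1) that bij_betwE by blast
  \<comment> \<open>Identifying two points of \<open>S\<close> is comparison with a pair atom, so
    knowing \<Phi> on these atoms determines the trace on \<open>S\<close> of every image.\<close>
  have key: "(h x, h y) \<in> \<Phi> r \<longleftrightarrow> (x, y) \<in> r" if r: "r \<in> X.R" and xy: "x \<in> S" "y \<in> S" for r x y
  proof (cases "x = y")
    case True
    then show ?thesis using X.R_refl[OF r xy(1)] Y.R_refl[OF in'[OF r] hS[OF xy(1)]] by simp
  next
    case False
    have p: "{x, y} \<in> pairs S" using xy False by (simp add: doubleton_in_pairs)
    have "(h x, h y) \<in> \<Phi> r \<longleftrightarrow> blk T {h x, h y} \<subseteq> \<Phi> r" using Y.blk_pair_le[OF in'[OF r]] by simp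
    also have "\<dots> \<longleftrightarrow> \<Phi> (blk S {x, y}) \<subseteq> \<Phi> r" using F(2)[OF p] h(2)[OF xy False] by simp
    also have "\<dots> \<longleftrightarrow> blk S {x, y} \<subseteq> r" using ord X.blk_pairs_in[OF p] r by simp
    also have "\<dots> \<longleftrightarrow> (x, y) \<in> r" using X.blk_pair_le[OF r] by simp
    finally show ?thesis .
  qed
  define k where "k = inv_into S h"
  have k: "bij_betw k T S" unfolding k_def by (rule bij_betw_inv_into[OF h(1)])
  have hk: "h (k v) = v" "k v \<in> S" if "v \<in> T" for v
    using h(1) that k unfolding k_def by (auto simp: bij_betw_inv_into_right bij_betw_apply)
  have kh: "k (h x) = x" if "x \<in> S" for x
    using h(1) that unfolding k_def by (simp add: bij_betw_inv_into_left)
  define \<Psi> where "\<Psi> = inv_into X.R \<Phi>"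
  have \<Psi>: "\<Psi> r \<in> X.R" "\<Phi> (\<Psi> r) = r" if "r \<in> Y.R" for r
    using bij that unfolding \<Psi>_def bij_betw_def by (auto simp: inv_into_into f_inv_into_f)
  have clo1: "closedin K' (h ` A)" if "closedin K A" "A \<subseteq> S" for A
    using closed_image_of_iso[OF X Y in' h(1) key that] .
  \<comment> \<open>The same argument with the two posets exchanged and the inverses of
    \<open>h\<close> and \<Phi>.\<close>
  have clo2: "closedin K (k ` B)" if "closedin K' B" "B \<subseteq> T" for B
  proof (rule closed_image_of_iso[OF Y X \<Psi>(1) k _ that])
    fix r u v assume r: "r \<in> Y.R" and uv: "u \<in> T" "v \<in> T"
    show "(k u, k v) \<in> \<Psi> r \<longleftrightarrow> (u, v) \<in> r"
      using key[OF \<Psi>(1)[OF r] hk(2)[OF uv(1)] hk(2)[OF uv(2)]] \<Psi>(2)[OF r] hk(1) uv by simp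
  qed
  have tS: "topspace (subtopology K S) = S" "topspace (subtopology K' T) = T"
    using X.closedS Y.closedS closedin_subset by fastforce+
  have "homeomorphic_maps (subtopology K S) (subtopology K' T) h k"
    unfolding homeomorphic_maps_def tS continuous_map_closedin
  proof (intro conjI ballI allI impI)
    fix C assume "closedin (subtopology K' T) C"
    then have C: "closedin K' C" "C \<subseteq> T" using Y.closedS by (auto simp: closedin_closed_subtopology)
    have "{x \<in> S. h x \<in> C} = k ` C"
      using kh hk C(2) by (auto simp: image_iff) metis
    then show "closedin (subtopology K S) {x \<in> S. h x \<in> C}"
      using clo2[OF C] X.closedS by (auto simp: closedin_closed_subtopology)
  next
    fix C assume "closedin (subtopology K S) C"
    then have C: "closedin K C" "C \<subseteq> S" using X.closedS by (auto simp: closedin_closed_subtopology)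
    have "{x \<in> T. k x \<in> C} = h ` C"
      using kh hk hS C(2) by (auto simp: image_iff) metis
    then show "closedin (subtopology K' T) {x \<in> T. k x \<in> C}"
      using clo1[OF C] Y.closedS hk(2) by (auto simp: closedin_closed_subtopology)
  qed (use kh hk hS in auto)
  then show ?thesis unfolding homeomorphic_space_def by blast
qed

section \<open>Subspaces of the compactification having the property\<close>

lemma perfect_map_quotient_top:
  assumes K: "compact_space K" "Hausdorff_space K"
    and clo: "closedin (prod_topology K K) {(x,y) \<in> topspace K \<times> topspace K. q x = q y}"
  shows "perfect_map K (quotient_top K q) q"
proof -
  have "continuous_map K (quotient_top K q) q"
    by (rule quotient_imp_continuous_map[OF quotient_map_quotient_top])
  moreover have "kc_space (quotient_top K q)"
    by (rule Hausdorff_imp_kc_space[OF Hausdorff_space_quotient_top[OF assms]])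
  ultimately show ?thesis
    using continuous_imp_proper_map[OF K(1)] by (simp add: perfect_map_def topspace_quotient_top)
qed

text \<open>Properness passes to full preimages, so \<open>D\<close> has to be saturated.\<close>

lemma perfect_map_restriction:
  assumes q: "perfect_map K Q q" and D: "{k \<in> topspace K. q k \<in> B} = D" and B: "B \<subseteq> topspace Q"
  shows "perfect_map (subtopology K D) (subtopology Q B) q"
proof -
  have "B \<subseteq> q ` topspace K"
    using perfect_imp_surjective_map[OF q] B by simp
  then have "q ` D = B" unfolding D[symmetric] by auto
  moreover have "D \<subseteq> topspace K" using D by blast
  ultimately show ?thesis
    unfolding perfect_map_def
    using proper_map_restriction[OF perfect_imp_proper_map[OF q] D] B
      continuous_map_from_subtopology[OF perfect_imp_continuous_map[OF q], of D]
    by (auto simp: continuous_map_in_subtopology Int_absorb1)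
qed

text \<open>A partial relation becomes the kernel of a map once the diagonal is added, and the
  diagonal is closed because \<open>K\<close> is Hausdorff.\<close>

lemma closed_kernel:
  assumes K: "Hausdorff_space K" and r: "closedin (prod_topology K K) r"
    and q: "\<And>x y. x \<in> topspace K \<Longrightarrow> y \<in> topspace K \<Longrightarrow> q x = q y \<longleftrightarrow> x = y \<or> (x, y) \<in> r"
  shows "closedin (prod_topology K K) {(x,y) \<in> topspace K \<times> topspace K. q x = q y}"
proof -
  have "r \<subseteq> topspace K \<times> topspace K" using closedin_subset[OF r] by simp
  then have "{(x,y) \<in> topspace K \<times> topspace K. q x = q y} = (\<lambda>x. (x, x)) ` topspace K \<union> r"
    using q by auto
  then show ?thesis
    using r K by (simp add: Hausdorff_space_closedin_diagonal closedin_Un)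
qed

text \<open>\<open>g\<close> leads into \<open>'u\<close> from two copies of
  \<open>'a set set\<close>, the type that carries the codes of points of \<open>K\<close> as well
  as the points of extensions.\<close>

locale sc_space =
  fixes P :: "'u topology \<Rightarrow> bool" and X :: "'a topology" and K :: "'k topology" and e :: "'a \<Rightarrow> 'k"
    and g :: "'a set set \<times> bool \<Rightarrow> 'u"
  assumes P: "compactness_like P" and tX: "tych X" and sc: "stone_cech X K e"
    and locP: "locally_P P X" and notP: "\<not> hasP P X" and inj_g: "inj g" and Xne: "topspace X \<noteq> {}"
begin

abbreviation "eX \<equiv> e ` topspace X"
abbreviation "lam \<equiv> lambdaP P X K e"
abbreviation "S \<equiv> topspace K - lam"

lemma K_compact: "compact_space K" and K_Hausdorff: "Hausdorff_space K" and emb: "embedding_map X K e"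
  and dense: "K closure_of eX = topspace K"
  using sc by (simp_all add: stone_cech_def)

lemma extend:
  assumes "continuous_map X (top_of_set {0..1::real}) f"
  obtains F where "continuous_map K (top_of_set {0..1::real}) F" "\<And>x. x \<in> topspace X \<Longrightarrow> F (e x) = f x"
proof -
  have "\<exists>F. continuous_map K (top_of_set {0..1::real}) F \<and> (\<forall>x\<in>topspace X. F (e x) = f x)"
    using sc assms by (simp add: stone_cech_def)
  then show thesis using that by blast
qed

lemma tychK: "tych K" using K_compact K_Hausdorff by (rule tych_compact_Hausdorff)

lemma hom: "homeomorphic_map X (subtopology K eX) e" using emb unfolding embedding_map_def .

lemma eX_sub: "eX \<subseteq> topspace K"
proof -
  have "eX = topspace (subtopology K eX)" by (rule homeomorphic_imp_surjective_map[OF hom])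
  also have "\<dots> \<subseteq> topspace K" by simp
  finally show ?thesis .
qed

lemma sub_homeomorphic:
  assumes "A \<subseteq> topspace X"
  shows "subtopology X A homeomorphic_space subtopology K (e ` A)"
proof -
  have "subtopology (subtopology K eX) (e ` A) = subtopology K (e ` A)"
    using assms by (simp add: subtopology_subtopology Int_absorb1 image_mono)
  then show ?thesis using homeomorphic_map_restrict[OF hom assms] by simp
qed

lemma hasP_sub_iff: "A \<subseteq> topspace X \<Longrightarrow> hasP P (subtopology X A) \<longleftrightarrow> hasP P (subtopology K (e ` A))"
  by (rule hasP_homeomorphic[OF sub_homeomorphic])

lemma e_closure:
  assumes "A \<subseteq> topspace X"
  shows "e ` (X closure_of A) = eX \<inter> K closure_of (e ` A)"
proof -
  have "e ` (X closure_of A) = subtopology K eX closure_of (e ` A)"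
    using homeomorphic_map_closure_of[OF hom assms] by simp
  also have "\<dots> = eX \<inter> K closure_of (e ` A)"
    using assms by (simp add: closure_of_subtopology Int_absorb1 image_mono)
  finally show ?thesis .
qed

lemma dense_open:
  assumes "openin K U"
  shows "U \<subseteq> K closure_of (e ` {x \<in> topspace X. e x \<in> U})"
proof -
  have "e ` {x \<in> topspace X. e x \<in> U} = U \<inter> eX" by auto
  moreover have "U \<inter> K closure_of eX \<subseteq> K closure_of (U \<inter> eX)"
    using assms by (rule openin_Int_closure_of_subset)
  ultimately show ?thesis using dense openin_subset[OF assms] by auto
qed

text \<open>A point of the compactification is determined by the subsets of \<open>X\<close> to which it adheres.\<close>

definition point_code :: "'k \<Rightarrow> 'a set set" where
  "point_code k = {A. A \<subseteq> topspace X \<and> k \<in> K closure_of (e ` A)}"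

text \<open>Given disjoint neighbourhoods of two points, the trace on X of the first adheres to the
  first point, by density, and not to the second.\<close>

lemma point_code_inj: "inj_on point_code (topspace K)"
proof (rule inj_onI, rule ccontr)
  fix k l assume kl: "k \<in> topspace K" "l \<in> topspace K" "point_code k = point_code l" "k \<noteq> l"
  then obtain U V where UV: "openin K U" "openin K V" "k \<in> U" "l \<in> V" "disjnt U V"
    using K_Hausdorff unfolding Hausdorff_space_def by metis
  let ?A = "{x \<in> topspace X. e x \<in> U}"
  have "?A \<in> point_code k" using dense_open[OF UV(1)] UV(3) unfolding point_code_def by auto
  moreover have "?A \<notin> point_code l"
    using UV(2,4,5) unfolding point_code_def in_closure_of disjnt_def by blast
  ultimately show False using kl by simp
qed

definition gK :: "'k \<times> bool \<Rightarrow> 'u" where "gK = (\<lambda>(k, b). g (point_code k, b))"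

lemma gK_inj: "inj_on gK (topspace K \<times> UNIV)"
  using point_code_inj inj_g unfolding gK_def inj_on_def by auto

lemma hasP_closed_K:
  assumes "Z \<subseteq> topspace K" "hasP P (subtopology K Z)" "closedin (subtopology K Z) A"
  shows "hasP P (subtopology K A)"
proof -
  have "A \<subseteq> Z" using closedin_subset[OF assms(3)] by auto
  then have "subtopology (subtopology K Z) A = subtopology K A"
    by (simp add: subtopology_subtopology Int_absorb1)
  moreover have "inj_on gK (topspace (subtopology K Z) \<times> UNIV)"
    by (rule inj_on_subset[OF gK_inj]) auto
  ultimately show ?thesis
    using hasP_closed[OF P _ tych_subtopology[OF tychK] assms(3,2)] by metis
qed

lemma hasP_closed_X:
  assumes "Z \<subseteq> topspace X" "hasP P (subtopology X Z)" "closedin X A" "A \<subseteq> Z"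
  shows "hasP P (subtopology X A)"
proof -
  have AX: "A \<subseteq> topspace X" using assms by blast
  have "closedin (subtopology K eX) (e ` A)" using homeomorphic_closedin[OF hom assms(3)] .
  then obtain D where D: "closedin K D" "e ` A = D \<inter> eX" unfolding closedin_subtopology by blast
  then have "e ` A = e ` Z \<inter> D" using assms(1,4) by blast
  then have "closedin (subtopology K (e ` Z)) (e ` A)"
    using D(1) by (simp add: closedin_subtopology_Int_closed)
  then show ?thesis
    using hasP_closed_K[of "e ` Z" "e ` A"] hasP_sub_iff[OF assms(1)] hasP_sub_iff[OF AX] assms(1,2) eX_sub
    by blast
qed

lemma hasP_Un_K:
  assumes "Z \<subseteq> topspace K" "closedin (subtopology K Z) A" "closedin (subtopology K Z) B"
    "hasP P (subtopology K A)" "hasP P (subtopology K B)"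
  shows "hasP P (subtopology K (A \<union> B))"
proof -
  have AB: "A \<subseteq> Z" "B \<subseteq> Z" using closedin_subset[OF assms(2)] closedin_subset[OF assms(3)] by auto
  then have eq: "subtopology (subtopology K Z) A = subtopology K A" "subtopology (subtopology K Z) B = subtopology K B"
    "subtopology (subtopology K Z) (A \<union> B) = subtopology K (A \<union> B)"
    by (simp_all add: subtopology_subtopology Int_absorb1)
  have "inj_on gK (topspace (subtopology K Z) \<times> UNIV)"
    by (rule inj_on_subset[OF gK_inj]) auto
  from hasP_closed_Un[OF P this tych_subtopology[OF tychK] assms(2,3)] eq assms(4,5)
  show ?thesis by simp
qed

text \<open>Starts the induction over finite unions in \<open>hasP_outside\<close>. The empty set is
  closed in a closed neighbourhood with the property, and such a neighbourhood exists because X has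
  a point.\<close>

lemma hasP_empty: "hasP P (subtopology K {})"
proof -
  obtain x where "x \<in> topspace X" using Xne by blast
  then obtain U where U: "hasP P (subtopology X (X closure_of U))"
    using locP unfolding locally_P_def by blast
  have "hasP P (subtopology X {})"
    using hasP_closed_X[OF closure_of_subset_topspace U closedin_empty] by blast
  then show ?thesis using hasP_sub_iff[of "{}"] by simp
qed

text \<open>The cozero-set of \<open>F\<close> in \<open>K\<close> is open and, by density of X,
  contained in the closure of its trace; hence it lies in the interior of that closure, and the
  trace is a cozero-set of X.\<close>

lemma lam_I:
  assumes F: "continuous_map K (top_of_set {0..1::real}) F"
    and h: "hasP P (subtopology X (X closure_of {x \<in> topspace X. F (e x) \<noteq> 0}))"
    and k: "k \<in> topspace K" "F k \<noteq> 0"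
  shows "k \<in> lam"
proof -
  let ?C = "{x \<in> topspace X. F (e x) \<noteq> 0}"
  let ?U = "{k \<in> topspace K. F k \<in> - {0}}"
  have "continuous_map K euclideanreal F" using F by (simp add: continuous_map_in_subtopology)
  then have U: "openin K ?U" by (rule openin_continuous_map_preimage) auto
  have "continuous_map X K e" using hom homeomorphic_imp_continuous_map continuous_map_in_subtopology by blast
  then have "continuous_map X (top_of_set {0..1}) (F \<circ> e)" using F continuous_map_compose by blast
  then have "?C \<in> coz X" unfolding coz_def by (auto simp: o_def)
  moreover have "{x \<in> topspace X. e x \<in> ?U} = ?C" using eX_sub by auto
  then have "?U \<subseteq> K interior_of (K closure_of (e ` ?C))"
    using dense_open[OF U] U by (simp add: interior_of_maximal)
  then have "k \<in> K interior_of (K closure_of (e ` ?C))" using k by auto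
  ultimately show ?thesis using h unfolding lambdaP_def by blast
qed

lemma eX_lam: "eX \<subseteq> lam"
proof clarify
  fix x assume x: "x \<in> topspace X"
  then obtain U where U: "openin X U" "x \<in> U" "hasP P (subtopology X (X closure_of U))"
    using locP unfolding locally_P_def by blast
  have "closedin X (topspace X - U)" using U(1) by blast
  then obtain f where f: "continuous_map X (top_of_set {0..1::real}) f" "f x = 0" "f ` (topspace X - U) \<subseteq> {1}"
    using tX x U(2) unfolding tych_def completely_regular_space_def by (metis DiffD2 DiffI)
  obtain F where F: "continuous_map K (top_of_set {0..1::real}) F" "\<And>x. x \<in> topspace X \<Longrightarrow> F (e x) = f x"
    using extend[OF f(1)] by blast
  \<comment> \<open>The separating function is 0 at \<open>x\<close> and 1 off \<open>U\<close>;
    flipping it moves the cozero-set into \<open>U\<close>.\<close>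
  let ?G = "\<lambda>k. 1 - F k"
  have G: "continuous_map K (top_of_set {0..1::real}) ?G"
    using F(1) by (auto simp: continuous_map_in_subtopology intro!: continuous_map_diff)
  let ?C = "{x \<in> topspace X. ?G (e x) \<noteq> 0}"
  have "?C \<subseteq> U" using F(2) f(3) by auto
  then have "X closure_of ?C \<subseteq> X closure_of U" by (rule closure_of_mono)
  then have "hasP P (subtopology X (X closure_of ?C))"
    by (intro hasP_closed_X[OF closure_of_subset_topspace U(3)]) auto
  then show "e x \<in> lam"
    by (rule lam_I[OF G]) (use x eX_sub F(2) f(2) in auto)
qed

lemma lam_open: "openin K lam"
  unfolding lambdaP_def by (intro openin_Union) auto

lemma S_closed: "closedin K S"
  using lam_open by blast

text \<open>The complement of \<open>V\<close> is compact and covered by the open sets that make up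
  \<open>lam\<close>. Finitely many of them suffice; the union of the corresponding closures in X
  has the property and contains \<open>eX - V\<close> as a closed subset.\<close>

lemma hasP_outside:
  assumes V: "openin K V" "S \<subseteq> V"
  shows "hasP P (subtopology K (eX - V))"
proof -
  let ?\<C> = "{C. C \<in> coz X \<and> hasP P (subtopology X (X closure_of C))}"
  let ?I = "\<lambda>C. K interior_of (K closure_of (e ` C))"
  have lam: "lam = \<Union>(?I ` ?\<C>)" unfolding lambdaP_def by blast
  have "compactin K (topspace K - V)"
    using V(1) K_compact by (intro closedin_compact_space) auto
  moreover have "topspace K - V \<subseteq> \<Union>(?I ` ?\<C>)" using V(2) lam by blast
  moreover have "\<And>U. U \<in> ?I ` ?\<C> \<Longrightarrow> openin K U" by auto
  ultimately obtain \<F> where \<F>: "finite \<F>" "\<F> \<subseteq> ?I ` ?\<C>" "topspace K - V \<subseteq> \<Union>\<F>"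
    using compactinD[of K "topspace K - V" "?I ` ?\<C>"] by blast
  then obtain \<D> where \<D>: "finite \<D>" "\<D> \<subseteq> ?\<C>" "\<F> = ?I ` \<D>"
    using finite_subset_image[OF \<F>(1,2)] by metis
  have cX: "C \<subseteq> topspace X" if "C \<in> \<D>" for C using that \<D>(2) unfolding coz_def by blast
  let ?U = "\<lambda>\<D>. \<Union>C\<in>\<D>. e ` (X closure_of C)"
  have clo: "closedin (subtopology K eX) (e ` (X closure_of C))" for C
    by (rule homeomorphic_closedin[OF hom]) auto
  have hU: "closedin (subtopology K eX) (?U \<D>) \<and> hasP P (subtopology K (?U \<D>))"
    using \<D>(1,2)
  proof (induction \<D> rule: finite_induct)
    case empty
    then show ?case using hasP_empty by simp
  next
    case (insert C \<D>)
    have "hasP P (subtopology K (e ` (X closure_of C)))"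
      using insert hasP_sub_iff[OF closure_of_subset_topspace[of X C]] by blast
    then have "hasP P (subtopology K (e ` (X closure_of C) \<union> ?U \<D>))"
      using insert clo by (intro hasP_Un_K[OF eX_sub]) auto
    then show ?case using insert clo by (simp add: closedin_Un)
  qed
  have sub: "eX - V \<subseteq> ?U \<D>"
  proof
    fix k assume k: "k \<in> eX - V"
    then have "k \<in> \<Union>\<F>" using \<F>(3) eX_sub by blast
    then obtain C where C: "C \<in> \<D>" "k \<in> ?I C" using \<D>(3) by blast
    have "k \<in> K closure_of (e ` C)" by (rule subsetD[OF interior_of_subset C(2)])
    then have "k \<in> e ` (X closure_of C)" using e_closure[OF cX[OF C(1)]] k by blast
    then show "k \<in> ?U \<D>" using C(1) by blast
  qed
  have UX: "?U \<D> \<subseteq> eX" using closedin_subset[OF conjunct1[OF hU]] by simp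
  have "eX - V = ?U \<D> \<inter> (topspace K - V)" using eX_sub sub UX by blast
  moreover have "closedin (subtopology K (?U \<D>)) (?U \<D> \<inter> (topspace K - V))"
    using V(1) by (intro closedin_subtopology_Int_closed) auto
  ultimately show ?thesis
    using hasP_closed_K[of "?U \<D>" "eX - V"] hU UX eX_sub by simp
qed

text \<open>Otherwise the empty set could serve as \<open>V\<close> in \<open>hasP_outside\<close>,
  giving the property to X itself.\<close>

lemma S_nonempty: "S \<noteq> {}"
proof
  assume "S = {}"
  then have "hasP P (subtopology K eX)" using hasP_outside[of "{}"] by simp
  then show False using notP hasP_sub_iff[of "topspace X"] by simp
qed

text \<open>A point off \<open>C\<close> has a cozero neighbourhood whose closure avoids
  \<open>C\<close>. The closure in X of its trace is then closed in \<open>eX \<union> C\<close>, so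
  it inherits the property and puts the point into \<open>lam\<close>.\<close>

lemma hasP_imp_S_subset:
  assumes C: "closedin K C" "C \<inter> eX = {}" and h: "hasP P (subtopology K (eX \<union> C))"
  shows "S \<subseteq> C"
proof
  fix k assume k: "k \<in> S"
  show "k \<in> C"
  proof (rule ccontr)
    assume "k \<notin> C"
    then obtain f where f: "continuous_map K (top_of_set {0..1::real}) f" "f k = 0" "f ` C \<subseteq> {1}"
      using tychK C(1) k unfolding tych_def completely_regular_space_def by (metis DiffD1 DiffI)
    have fr: "continuous_map K euclideanreal f" "\<And>l. l \<in> topspace K \<Longrightarrow> 0 \<le> f l"
      using f(1) by (auto simp: continuous_map_in_subtopology)
    \<comment> \<open>\<open>?F\<close> is nonzero exactly where \<open>f\<close> is below 1/2, so
      the closure of that set stays where \<open>f\<close> is at most 1/2, away from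
      \<open>C\<close>, where \<open>f\<close> is 1.\<close>
    let ?F = "\<lambda>l. max 0 (1 - 2 * f l)"
    have F: "continuous_map K (top_of_set {0..1::real}) ?F"
      using fr by (auto simp: continuous_map_in_subtopology intro!: continuous_intros)
    let ?A = "{x \<in> topspace X. ?F (e x) \<noteq> 0}"
    let ?D = "{l \<in> topspace K. f l \<in> {..1/2}}"
    have "closedin K ?D" using fr(1) by (rule closedin_continuous_map_preimage) auto
    moreover have "e ` ?A \<subseteq> ?D" using eX_sub by (auto simp: max_def split: if_splits)
    ultimately have AD: "K closure_of (e ` ?A) \<subseteq> ?D" by (simp add: closure_of_minimal)
    have "?D \<inter> C = {}" using f(3) by auto
    then have "e ` (X closure_of ?A) = (eX \<union> C) \<inter> K closure_of (e ` ?A)"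
      using AD e_closure[of ?A] by blast
    then have "closedin (subtopology K (eX \<union> C)) (e ` (X closure_of ?A))"
      by (simp add: closedin_subtopology_Int_closed)
    moreover have "eX \<union> C \<subseteq> topspace K" using eX_sub C(1) closedin_subset by blast
    ultimately have "hasP P (subtopology K (e ` (X closure_of ?A)))"
      using hasP_closed_K h by blast
    then have "hasP P (subtopology X (X closure_of ?A))"
      using hasP_sub_iff[OF closure_of_subset_topspace[of X ?A]] by blast
    then have "k \<in> lam" by (rule lam_I[OF F]) (use k f(2) in auto)
    then show False using k by blast
  qed
qed

text \<open>Collapsing \<open>C\<close> to a point is a perfect map, and the collapsed space satisfies
  the hypothesis of condition (W) at that point.\<close>

lemma S_subset_imp_hasP:
  assumes C: "closedin K C" "C \<inter> eX = {}" and SC: "S \<subseteq> C"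
  shows "hasP P (subtopology K (eX \<union> C))"
proof -
  obtain c where c: "c \<in> C" using S_nonempty SC by blast
  have CK: "C \<subseteq> topspace K" using C(1) closedin_subset by blast
  \<comment> \<open>\<open>c\<close> stands for the collapsed set. Point codes as values place the
    quotient on \<open>'a set set\<close>, from where \<open>g\<close> leads into
    \<open>'u\<close>.\<close>
  define q where "q k = (if k \<in> C then point_code c else point_code k)" for k
  have q: "q x = q y \<longleftrightarrow> x = y \<or> (x, y) \<in> C \<times> C" if "x \<in> topspace K" "y \<in> topspace K" for x y
    using that c CK inj_onD[OF point_code_inj] unfolding q_def by (smt (verit) SigmaD1 SigmaD2 SigmaI subsetD)
  have "closedin (prod_topology K K) (C \<times> C)" using C(1) by (simp add: closedin_prod_Times_iff)
  then have ker: "closedin (prod_topology K K) {(x,y) \<in> topspace K \<times> topspace K. q x = q y}"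
    using closed_kernel[OF K_Hausdorff _ q] by blast
  define Q where "Q = quotient_top K q"
  have pQ: "perfect_map K Q q" unfolding Q_def by (rule perfect_map_quotient_top[OF K_compact K_Hausdorff ker])
  have tQ: "tych Q" unfolding Q_def
    by (intro tych_compact_Hausdorff compact_space_quotient_top Hausdorff_space_quotient_top K_compact K_Hausdorff ker)
  have topQ: "topspace Q = q ` topspace K" by (simp add: Q_def topspace_quotient_top)
  have injQ: "inj_on (\<lambda>z. g (z, True)) A" for A using inj_g by (auto simp: inj_on_def)
  have injK: "inj_on (\<lambda>k. gK (k, True)) (topspace (subtopology K A))" for A
    using gK_inj by (auto simp: inj_on_def)
  have transfer: "hasP P (subtopology K D) \<longleftrightarrow> hasP P (subtopology Q (q ` D))"
    if D: "D \<subseteq> topspace K" "\<And>x y. x \<in> topspace K \<Longrightarrow> y \<in> D \<Longrightarrow> q x = q y \<Longrightarrow> x \<in> D" for D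
  proof (rule hasP_perfect[OF P injK injQ])
    show "perfect_map (subtopology K D) (subtopology Q (q ` D)) q"
      by (rule perfect_map_restriction[OF pQ]) (use D topQ in auto)
  qed (simp_all add: tych_subtopology tychK tQ)
  define Z where "Z = subtopology Q (q ` (eX \<union> C))"
  have "hasP P Z"
  proof (rule hasP_W[OF P injQ])
    show "tych Z" unfolding Z_def by (rule tych_subtopology[OF tQ])
    have tZ: "topspace Z = q ` (eX \<union> C)" unfolding Z_def using topQ eX_sub CK by auto
    show "point_code c \<in> topspace Z" unfolding tZ using c by (auto simp: q_def intro!: image_eqI[of _ q c])
    fix V assume V: "openin Z V" "point_code c \<in> V"
    then obtain V' where V': "openin Q V'" "V = V' \<inter> q ` (eX \<union> C)"
      unfolding Z_def openin_subtopology by blast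
    let ?V = "{k \<in> topspace K. q k \<in> V'}"
    have oV: "openin K ?V"
      using perfect_imp_continuous_map[OF pQ] V'(1) openin_continuous_map_preimage by blast
    \<comment> \<open>A neighbourhood of the collapsed point pulls back to an open set around
      \<open>C\<close>, hence around \<open>S\<close>, so \<open>hasP_outside\<close> applies to
      what remains of X.\<close>
    have CV: "C \<subseteq> ?V" using V(2) V'(2) CK by (auto simp: q_def)
    then have hP: "hasP P (subtopology K (eX - ?V))" using hasP_outside[OF oV] SC by blast
    have "x \<in> eX - ?V" if "x \<in> topspace K" "y \<in> eX - ?V" "q x = q y" for x y
    proof -
      have "y \<in> topspace K" "y \<notin> C" using that C(2) eX_sub by blast+
      then have "x = y" using q that by blast
      then show ?thesis using that by blast
    qed
    then have "hasP P (subtopology Q (q ` (eX - ?V)))" using hP transfer[of "eX - ?V"] eX_sub by blast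
    moreover have "q ` (eX - ?V) = topspace Z - V"
      unfolding tZ V'(2) using eX_sub CV by auto
    moreover have "subtopology Q (topspace Z - V) = subtopology Z (topspace Z - V)"
      unfolding Z_def subtopology_subtopology using tZ unfolding Z_def by (simp add: Int_absorb1)
    ultimately show "hasP P (subtopology Z (topspace Z - V))" by simp
  qed
  moreover have "x \<in> eX \<union> C" if "x \<in> topspace K" "y \<in> eX \<union> C" "q x = q y" for x y
    using q[of x y] that eX_sub CK by blast
  ultimately show ?thesis using transfer[of "eX \<union> C"] eX_sub CK unfolding Z_def by blast
qed

lemma hasP_iff_S_subset:
  "closedin K C \<Longrightarrow> C \<inter> eX = {} \<Longrightarrow> hasP P (subtopology K (eX \<union> C)) \<longleftrightarrow> S \<subseteq> C"
  using hasP_imp_S_subset S_subset_imp_hasP by blast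

end

section \<open>Extensions as closed partial equivalence relations\<close>

context sc_space
begin

text \<open>\<open>eX \<union> C\<close> is the largest subspace of the compactification to which
  \<open>e x \<mapsto> t x\<close> extends continuously with values in \<open>T\<close>, and \<open>\<psi>\<close> is that extension.\<close>

definition canon :: "'e topology \<Rightarrow> ('a \<Rightarrow> 'e) \<Rightarrow> 'k set \<Rightarrow> ('k \<Rightarrow> 'e) \<Rightarrow> bool" where
  "canon T t C \<psi> \<longleftrightarrow> closedin K C \<and> C \<inter> eX = {} \<and> perfect_map (subtopology K (eX \<union> C)) T \<psi> \<and>
     (\<forall>x\<in>topspace X. \<psi> (e x) = t x) \<and> \<psi> ` C = topspace T - t ` topspace X \<and>
     (\<forall>C' f. C' \<subseteq> topspace K \<and> C' \<inter> eX = {} \<and> continuous_map (subtopology K (eX \<union> C')) T f \<and>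
        (\<forall>x\<in>topspace X. f (e x) = t x) \<longrightarrow> C' \<subseteq> C \<and> (\<forall>k\<in>C'. f k = \<psi> k))"

lemma canonD:
  assumes "canon T t C \<psi>"
  shows canon_closed: "closedin K C" and canon_disjoint: "C \<inter> eX = {}"
    and canon_perfect: "perfect_map (subtopology K (eX \<union> C)) T \<psi>"
    and canon_e: "x \<in> topspace X \<Longrightarrow> \<psi> (e x) = t x"
    and canon_image: "\<psi> ` C = topspace T - t ` topspace X"
    and canon_max: "\<lbrakk>C' \<subseteq> topspace K; C' \<inter> eX = {}; continuous_map (subtopology K (eX \<union> C')) T f;
       \<And>x. x \<in> topspace X \<Longrightarrow> f (e x) = t x\<rbrakk> \<Longrightarrow> C' \<subseteq> C \<and> (\<forall>k\<in>C'. f k = \<psi> k)"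
proof -
  note d = assms[unfolded canon_def]
  show "closedin K C" "C \<inter> eX = {}" "perfect_map (subtopology K (eX \<union> C)) T \<psi>"
    "x \<in> topspace X \<Longrightarrow> \<psi> (e x) = t x" "\<psi> ` C = topspace T - t ` topspace X"
    using d by simp_all
  show "\<lbrakk>C' \<subseteq> topspace K; C' \<inter> eX = {}; continuous_map (subtopology K (eX \<union> C')) T f;
       \<And>x. x \<in> topspace X \<Longrightarrow> f (e x) = t x\<rbrakk> \<Longrightarrow> C' \<subseteq> C \<and> (\<forall>k\<in>C'. f k = \<psi> k)"
    using d[THEN conjunct2, THEN conjunct2, THEN conjunct2, THEN conjunct2, THEN conjunct2, THEN spec, THEN spec, of C' f]
    by blast
qed

text \<open>Serves two ambient spaces \<open>Q\<close>: a cube, for an arbitrary extension, and a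
  quotient of \<open>K\<close>, for the extension built from a relation. In both, \<open>C\<close>
  is the preimage of the remainder of \<open>T\<close> under \<open>q\<close>.\<close>

lemma canon_from_map:
  assumes ext: "is_ext X T t" and com: "compactin T (topspace T - t ` topspace X)"
    and Q: "Hausdorff_space Q" and q: "continuous_map K Q q" and c: "embedding_map T Q c"
    and qe: "\<And>x. x \<in> topspace X \<Longrightarrow> q (e x) = c (t x)"
  obtains \<psi> where "canon T t {k \<in> topspace K. q k \<in> c ` (topspace T - t ` topspace X)} \<psi>"
    "\<And>k. k \<in> topspace K \<Longrightarrow> q k \<in> c ` topspace T \<Longrightarrow> c (\<psi> k) = q k"
proof -
  let ?tX = "t ` topspace X"
  define C where "C = {k \<in> topspace K. q k \<in> c ` (topspace T - ?tX)}"
  have et: "homeomorphic_map X (subtopology T ?tX) t" and dT: "T closure_of ?tX = topspace T"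
    using ext by (simp_all add: is_ext_def embedding_map_def)
  have contt: "continuous_map X T t"
    using homeomorphic_imp_continuous_map[OF et] by (simp add: continuous_map_in_subtopology)
  then have tX: "?tX \<subseteq> topspace T" by (rule continuous_map_image_subset_topspace)
  have hc: "homeomorphic_map T (subtopology Q (c ` topspace T)) c" using c unfolding embedding_map_def .
  have cinj: "inj_on c (topspace T)" by (rule homeomorphic_imp_injective_map[OF hc])
  have contc: "continuous_map T Q c"
    using homeomorphic_imp_continuous_map[OF hc] by (simp add: continuous_map_in_subtopology)
  obtain c' where c': "homeomorphic_maps T (subtopology Q (c ` topspace T)) c c'"
    using hc unfolding homeomorphic_map_maps by blast
  have c'c: "c' (c y) = y" if "y \<in> topspace T" for y
    using c' that unfolding homeomorphic_maps_def by blast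
  have cQ: "c ` topspace T \<subseteq> topspace Q" using contc by (rule continuous_map_image_subset_topspace)
  have C_closed: "closedin K C" unfolding C_def
    by (rule closedin_continuous_map_preimage[OF q compactin_imp_closedin[OF Q image_compactin[OF com contc]]])
  have C_disj: "C \<inter> eX = {}"
  proof -
    have False if x: "x \<in> topspace X" and ex: "e x \<in> C" for x
    proof -
      obtain y where y: "y \<in> topspace T - ?tX" "q (e x) = c y" using ex unfolding C_def by blast
      then have "c y = c (t x)" using qe[OF x] by simp
      then have "y = t x" using cinj y(1) x tX by (simp add: inj_on_eq_iff image_subset_iff)
      then show False using y(1) x by blast
    qed
    then show ?thesis by blast
  qed
  \<comment> \<open>No new point of \<open>K\<close> lies over a point of X. If \<open>k\<close> is
    separated from \<open>e x\<close>, points of X near \<open>k\<close> have images near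
    \<open>t x\<close>, and as \<open>t\<close> is an embedding they lie near \<open>e x\<close>, a
    contradiction.\<close>
  have k_in: "k \<in> eX" if k: "k \<in> topspace K" and x: "x \<in> topspace X" and qk: "q k = c (t x)" for k x
  proof (rule ccontr)
    assume "k \<notin> eX"
    then have "k \<noteq> e x" "e x \<in> topspace K" using x eX_sub by blast+
    then obtain U V where UV: "openin K U" "openin K V" "k \<in> U" "e x \<in> V" "disjnt U V"
      using K_Hausdorff k unfolding Hausdorff_space_def by metis
    let ?V = "{x \<in> topspace X. e x \<in> V}"
    have "continuous_map X K e"
      using homeomorphic_imp_continuous_map[OF hom] by (simp add: continuous_map_in_subtopology)
    then have "openin X ?V" using UV(2) by (rule openin_continuous_map_preimage)
    then have "openin (subtopology T ?tX) (t ` ?V)" by (rule homeomorphic_openin[OF et])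
    then obtain W where W: "openin T W" "t ` ?V = W \<inter> ?tX" unfolding openin_subtopology by blast
    have "openin (subtopology Q (c ` topspace T)) (c ` W)" by (rule homeomorphic_openin[OF hc W(1)])
    then obtain W2 where W2: "openin Q W2" "c ` W = W2 \<inter> c ` topspace T" unfolding openin_subtopology by blast
    have "t x \<in> t ` ?V" using x UV(4) by blast
    then have "c (t x) \<in> W2" using W(2) W2(2) by blast
    let ?O = "{k \<in> topspace K. q k \<in> W2} \<inter> U"
    have "openin K ?O" using openin_continuous_map_preimage[OF q W2(1)] UV(1) by blast
    moreover have "k \<in> ?O" using k qk \<open>c (t x) \<in> W2\<close> UV(3) by simp
    moreover have "k \<in> K closure_of eX" using dense k by simp
    ultimately have "\<exists>l. l \<in> eX \<and> l \<in> ?O"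
      unfolding in_closure_of by metis
    then obtain x' where x': "x' \<in> topspace X" "e x' \<in> ?O" by blast
    then have "c (t x') \<in> c ` W" using qe[OF x'(1)] W2(2) x'(1) tX by auto
    then have "t x' \<in> W" using cinj openin_subset[OF W(1)] x'(1) tX
      by (metis image_eqI inj_on_image_mem_iff subsetD)
    then have "t x' \<in> t ` ?V" using W(2) x'(1) by blast
    then obtain x2 where x2: "x2 \<in> ?V" "t x' = t x2" by blast
    then have "x' = x2" using homeomorphic_imp_injective_map[OF et] x'(1) by (simp add: inj_on_eq_iff)
    then have "e x' \<in> V" using x2(1) by blast
    then show False using x'(2) UV(5) unfolding disjnt_def by blast
  qed
  have D: "{k \<in> topspace K. q k \<in> c ` topspace T} = eX \<union> C"
  proof
    show "{k \<in> topspace K. q k \<in> c ` topspace T} \<subseteq> eX \<union> C"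
    proof clarify
      fix k y assume k: "k \<in> topspace K" "k \<notin> C" "q k = c y" "y \<in> topspace T"
      show "k \<in> eX"
      proof (cases "y \<in> ?tX")
        case True
        then obtain x where "x \<in> topspace X" "y = t x" by blast
        then show ?thesis using k_in[OF k(1)] k(3) by blast
      next
        case False
        then show ?thesis using k unfolding C_def by blast
      qed
    qed
    show "eX \<union> C \<subseteq> {k \<in> topspace K. q k \<in> c ` topspace T}"
      using qe eX_sub tX unfolding C_def by auto
  qed
  \<comment> \<open>The image of the compact space \<open>K\<close> is closed and contains the image
    of X, which is dense in \<open>T\<close>.\<close>
  have onto: "c ` topspace T \<subseteq> q ` topspace K"
  proof -
    have "compactin Q (q ` topspace K)"
      using image_compactin[OF _ q, of "topspace K"] K_compact by (simp add: compact_space_def)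
    then have cl: "closedin Q (q ` topspace K)" by (rule compactin_imp_closedin[OF Q])
    have "c ` ?tX \<subseteq> q ` topspace K"
    proof clarify
      fix x assume x: "x \<in> topspace X"
      then have "c (t x) = q (e x)" "e x \<in> topspace K" using qe eX_sub by auto
      then show "c (t x) \<in> q ` topspace K" by simp
    qed
    then have "Q closure_of (c ` ?tX) \<subseteq> q ` topspace K" using cl by (rule closure_of_minimal)
    moreover have "c ` (T closure_of ?tX) \<subseteq> Q closure_of (c ` ?tX)"
      using contc by (rule continuous_map_image_closure_subset)
    ultimately show ?thesis using dT by simp
  qed
  \<comment> \<open>Continuous maps from compact to Hausdorff spaces are proper; by \<open>D\<close>
    the set \<open>eX \<union> C\<close> is a full preimage, so properness restricts.\<close>
  have "proper_map K Q q" by (rule continuous_imp_proper_map[OF K_compact Hausdorff_imp_kc_space[OF Q] q])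
  then have "proper_map (subtopology K (eX \<union> C)) (subtopology Q (c ` topspace T)) q"
    using D by (rule proper_map_restriction)
  moreover have im: "q ` (eX \<union> C) = c ` topspace T" 
  proof
    show "q ` (eX \<union> C) \<subseteq> c ` topspace T" unfolding D[symmetric] by blast
    show "c ` topspace T \<subseteq> q ` (eX \<union> C)"
    proof
      fix z assume z: "z \<in> c ` topspace T"
      then have "z \<in> q ` topspace K" by (rule subsetD[OF onto])
      then obtain k where k: "k \<in> topspace K" "z = q k" by (rule imageE)
      then have "k \<in> {k \<in> topspace K. q k \<in> c ` topspace T}" using z by simp
      then have "k \<in> eX \<union> C" by (simp only: D)
      then show "z \<in> q ` (eX \<union> C)" using k(2) by (rule image_eqI[rotated])
    qed
  qed
  moreover have DK: "eX \<union> C \<subseteq> topspace K" using D by blast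
  then have tD: "topspace (subtopology K (eX \<union> C)) = eX \<union> C" "topspace (subtopology Q (c ` topspace T)) = c ` topspace T"
    using cQ by (simp_all only: topspace_subtopology Int_absorb1)
  moreover have "continuous_map (subtopology K (eX \<union> C)) (subtopology Q (c ` topspace T)) q"
    by (rule continuous_map_into_subtopology[OF continuous_map_from_subtopology[OF q]])
       (unfold tD image_subset_iff_funcset[symmetric] im, rule order_refl)
  ultimately have "perfect_map (subtopology K (eX \<union> C)) (subtopology Q (c ` topspace T)) q"
    unfolding perfect_map_def by metis
  moreover have "perfect_map (subtopology Q (c ` topspace T)) T c'"
    using c'[unfolded homeomorphic_maps_sym[of T]] homeomorphic_imp_perfect_map
    unfolding homeomorphic_map_maps by blast
  ultimately have perf: "perfect_map (subtopology K (eX \<union> C)) T (c' \<circ> q)"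
    by (rule perfect_map_compose)
  define \<psi> where "\<psi> = c' \<circ> q"
  have c\<psi>: "c (\<psi> k) = q k" if "k \<in> topspace K" "q k \<in> c ` topspace T" for k
    using that c'c unfolding \<psi>_def by auto
  have \<psi>T: "\<psi> k \<in> topspace T" if "k \<in> topspace K" "q k \<in> c ` topspace T" for k
    using that c'c unfolding \<psi>_def by auto
  have "canon T t C \<psi>"
    unfolding canon_def
  proof (intro conjI allI impI ballI)
    show "closedin K C" "C \<inter> eX = {}" "perfect_map (subtopology K (eX \<union> C)) T \<psi>"
      using C_closed C_disj perf unfolding \<psi>_def by auto
    show "\<psi> (e x) = t x" if "x \<in> topspace X" for x
      using qe[OF that] c'c[of "t x"] tX that unfolding \<psi>_def by auto
    show "\<psi> ` C = topspace T - ?tX"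
    proof
      show "\<psi> ` C \<subseteq> topspace T - ?tX"
      proof
        fix y assume "y \<in> \<psi> ` C"
        then obtain k z where "k \<in> C" "y = c' (q k)" "q k = c z" "z \<in> topspace T - ?tX"
          unfolding \<psi>_def C_def by auto
        then show "y \<in> topspace T - ?tX" using c'c by auto
      qed
      show "topspace T - ?tX \<subseteq> \<psi> ` C"
      proof
        fix y assume y: "y \<in> topspace T - ?tX"
        then obtain k where k: "k \<in> topspace K" "q k = c y" using onto by (metis DiffD1 imageE image_eqI subsetD)
        then have "k \<in> C" unfolding C_def using y by auto
        moreover have "\<psi> k = y" using k c'c y unfolding \<psi>_def by auto
        ultimately show "y \<in> \<psi> ` C" by blast
      qed
    qed
  next
    fix C' f assume a: "C' \<subseteq> topspace K \<and> C' \<inter> eX = {} \<and> continuous_map (subtopology K (eX \<union> C')) T f \<and>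
        (\<forall>x\<in>topspace X. f (e x) = t x)"
    let ?D = "eX \<union> C'"
    \<comment> \<open>Two continuous maps into the Hausdorff space \<open>Q\<close> that agree on
      the dense set \<open>eX\<close> agree on \<open>?D\<close>.\<close>
    have *: "c (f k) = q k \<and> f k \<in> topspace T" if k: "k \<in> C'" for k
    proof
      have "subtopology K ?D closure_of eX = ?D \<inter> K closure_of (?D \<inter> eX)" by (rule closure_of_subtopology)
      also have "?D \<inter> eX = eX" by blast
      finally have "k \<in> subtopology K ?D closure_of eX" using dense a k by blast
      moreover have "continuous_map (subtopology K ?D) Q (c \<circ> f)" using a contc continuous_map_compose by blast
      moreover have "continuous_map (subtopology K ?D) Q q" by (rule continuous_map_from_subtopology[OF q])
      ultimately have "(c \<circ> f) k = q k"
        by (rule forall_in_closure_of_eq[OF _ Q]) (use a qe in auto)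
      then show "c (f k) = q k" by simp
      have "k \<in> topspace (subtopology K ?D)" using k a by auto
      then show "f k \<in> topspace T" using continuous_map_image_subset_topspace[of "subtopology K ?D" T f] a by blast
    qed
    show "C' \<subseteq> C"
    proof
      fix k assume k: "k \<in> C'"
      then have "q k \<in> c ` topspace T" "k \<in> topspace K" "k \<notin> eX" using *[OF k] a by (metis image_eqI, blast+)
      then show "k \<in> C" using D by blast
    qed
    fix k assume k: "k \<in> C'"
    then have "q k \<in> c ` topspace T" "k \<in> topspace K" using *[OF k] a by (metis image_eqI, blast)
    then show "f k = \<psi> k" using c\<psi> *[OF k] \<psi>T cinj by (metis inj_onD)
  qed
  then show thesis using that c\<psi> unfolding C_def by blast
qed

text \<open>The defining property of \<open>stone_cech\<close> extends functions into the unit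
  interval only; embedding \<open>T\<close> in a cube reduces the extension of \<open>t\<close> to
  its coordinates.\<close>

lemma canon_exists:
  assumes ext: "is_ext X T t" and com: "compactin T (topspace T - t ` topspace X)"
  shows "\<exists>C \<psi>. canon T t C \<psi>"
proof -
  have tT: "completely_regular_space T" "Hausdorff_space T" using ext unfolding is_ext_def tych_def by auto
  obtain I :: "('b \<Rightarrow> real) set" and c where c: "embedding_map T (product_topology (\<lambda>f. top_of_set {0..1::real}) I) c"
    using completely_regular_space_cube_embedding[OF tT] by blast
  define Q where "Q = product_topology (\<lambda>f::'b \<Rightarrow> real. top_of_set {0..1::real}) I"
  have HQ: "Hausdorff_space Q" unfolding Q_def
    by (simp add: Hausdorff_space_product_topology Hausdorff_space_subtopology)
  have cQ: "embedding_map T Q c" using c unfolding Q_def .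
  then have contc: "continuous_map T Q c"
    unfolding embedding_map_def by (auto dest: homeomorphic_imp_continuous_map simp: continuous_map_in_subtopology)
  have contt: "continuous_map X T t"
    using ext unfolding is_ext_def embedding_map_def
    by (auto dest: homeomorphic_imp_continuous_map simp: continuous_map_in_subtopology)
  have ct: "continuous_map X Q (c \<circ> t)" using contt contc by (rule continuous_map_compose)
  then have comp: "continuous_map X (top_of_set {0..1::real}) (\<lambda>x. c (t x) i)" if "i \<in> I" for i
    using that unfolding Q_def continuous_map_componentwise by (auto simp: o_def)
  have "\<exists>F. continuous_map K (top_of_set {0..1::real}) F \<and> (\<forall>x\<in>topspace X. F (e x) = c (t x) i)" if "i \<in> I" for i
    using extend[OF comp[OF that]] by metis
  then obtain F where F: "\<And>i. i \<in> I \<Longrightarrow> continuous_map K (top_of_set {0..1::real}) (F i)"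
     "\<And>i x. i \<in> I \<Longrightarrow> x \<in> topspace X \<Longrightarrow> F i (e x) = c (t x) i"
    by metis
  define q where "q k = restrict (\<lambda>i. F i k) I" for k
  have q: "continuous_map K Q q"
    unfolding Q_def continuous_map_componentwise
  proof (intro conjI ballI)
    fix i assume i: "i \<in> I"
    then have "(\<lambda>k. q k i) = F i" by (auto simp: q_def)
    then show "continuous_map K (top_of_set {0..1}) (\<lambda>k. q k i)" using F(1)[OF i] by simp
  qed (auto simp: q_def)
  have "q (e x) = c (t x)" if x: "x \<in> topspace X" for x
  proof
    fix i
    have "(c \<circ> t) x \<in> topspace Q" using continuous_map_image_subset_topspace[OF ct] x by blast
    \<comment> \<open>Points of the product are \<open>undefined\<close> outside \<open>I\<close>,
      as are the values of \<open>q\<close> by \<open>restrict\<close>.\<close>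
    then have "c (t x) \<in> extensional I" unfolding Q_def by (auto simp: PiE_def)
    then show "q (e x) i = c (t x) i" using F(2)[OF _ x] by (auto simp: q_def extensional_def)
  qed
  then show ?thesis using canon_from_map[OF ext com HQ q cQ] by metis
qed

text \<open>Each of the two is a competitor in the maximality clause of the other.\<close>

lemma canon_unique:
  assumes "canon T t C \<psi>" "canon T t C' \<psi>'"
  shows "C = C'" "\<And>k. k \<in> C \<Longrightarrow> \<psi> k = \<psi>' k"
proof -
  have 1: "C \<subseteq> C' \<and> (\<forall>k\<in>C. \<psi> k = \<psi>' k)"
    using assms closedin_subset[OF canon_closed[OF assms(1)]] canon_disjoint[OF assms(1)]
      perfect_imp_continuous_map[OF canon_perfect[OF assms(1)]] canon_e[OF assms(1)]
    by (intro canon_max[OF assms(2)])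
  have 2: "C' \<subseteq> C \<and> (\<forall>k\<in>C'. \<psi>' k = \<psi> k)"
    using assms closedin_subset[OF canon_closed[OF assms(2)]] canon_disjoint[OF assms(2)]
      perfect_imp_continuous_map[OF canon_perfect[OF assms(2)]] canon_e[OF assms(2)]
    by (intro canon_max[OF assms(1)])
  show "C = C'" using 1 2 by blast
  show "\<And>k. k \<in> C \<Longrightarrow> \<psi> k = \<psi>' k" using 1 by blast
qed

text \<open>The carrier type of \<open>T\<close> is fixed so that \<open>g\<close> provides its copy
  on \<open>'u\<close>.\<close>

lemma hasP_iff_canon:
  fixes T :: "'a set set topology"
  assumes "canon T t C \<psi>" "tych T"
  shows "hasP P T \<longleftrightarrow> S \<subseteq> C"
proof -
  have "hasP P (subtopology K (eX \<union> C)) \<longleftrightarrow> hasP P T"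
  proof (rule hasP_perfect[OF P])
    show "inj_on (\<lambda>k. gK (k, True)) (topspace (subtopology K (eX \<union> C)))"
      using gK_inj by (auto simp: inj_on_def)
    show "inj_on (\<lambda>z. g (z, True)) (topspace T)" using inj_g by (auto simp: inj_on_def)
    show "tych (subtopology K (eX \<union> C))" by (rule tych_subtopology[OF tychK])
    show "perfect_map (subtopology K (eX \<union> C)) T \<psi>" by (rule canon_perfect[OF assms(1)])
  qed fact
  then show ?thesis using hasP_iff_S_subset[OF canon_closed[OF assms(1)] canon_disjoint[OF assms(1)]] by simp
qed

text \<open>The quantifier makes the relation depend on the extension alone; by
  \<open>canon_unique\<close> the witnesses do not matter.\<close>

definition rel :: "'e topology \<times> ('a \<Rightarrow> 'e) \<Rightarrow> ('k \<times> 'k) set" where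
  "rel E = {(k, l). \<exists>C \<psi>. canon (fst E) (snd E) C \<psi> \<and> k \<in> C \<and> l \<in> C \<and> \<psi> k = \<psi> l}"

lemma rel_canon:
  assumes "canon T t C \<psi>"
  shows "rel (T, t) = {(k, l). k \<in> C \<and> l \<in> C \<and> \<psi> k = \<psi> l}"
proof
  show "rel (T, t) \<subseteq> {(k, l). k \<in> C \<and> l \<in> C \<and> \<psi> k = \<psi> l}"
    unfolding rel_def fst_conv snd_conv
  proof clarify
    fix k l C' \<psi>' assume c: "canon T t C' \<psi>'" and kl: "k \<in> C'" "l \<in> C'" "\<psi>' k = \<psi>' l"
    have "C' = C" by (rule canon_unique(1)[OF c assms])
    moreover have "\<psi>' k = \<psi> k" "\<psi>' l = \<psi> l" using canon_unique(2)[OF c assms] kl by simp_all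
    ultimately show "k \<in> C \<and> l \<in> C \<and> \<psi> k = \<psi> l" using kl by simp
  qed
  show "{(k, l). k \<in> C \<and> l \<in> C \<and> \<psi> k = \<psi> l} \<subseteq> rel (T, t)"
    unfolding rel_def using assms by auto
qed

section \<open>The order of extensions as reverse inclusion\<close>

abbreviation "PERs \<equiv> closed_pers K (topspace K - eX) S"
abbreviation reps :: "('a set set topology \<times> ('a \<Rightarrow> 'a set set)) set" where "reps \<equiv> EP_reps P X"

lemma repsE:
  assumes "E \<in> reps"
  obtains T t C \<psi> where "E = (T, t)" "is_ext X T t" "tych T" "hasP P T" "canon T t C \<psi>" "S \<subseteq> C"
proof -
  obtain T t where Tt: "E = (T, t)" "is_ext X T t" "hasP P T" "compactin T (topspace T - t ` topspace X)"
    using assms unfolding EP_reps_def by blast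
  then obtain C \<psi> where c: "canon T t C \<psi>" using canon_exists by blast
  have "tych T" using Tt(2) unfolding is_ext_def by blast
  moreover from this have "S \<subseteq> C" using hasP_iff_canon[OF c] Tt(3) by blast
  ultimately show thesis using that Tt(1-3) c by blast
qed

text \<open>Closed because \<open>T\<close> is Hausdorff, so that \<open>\<psi>\<close> has a closed
  kernel on \<open>C\<close>, and \<open>C\<close> is closed in \<open>K\<close>.\<close>

lemma rel_in:
  assumes "E \<in> reps"
  shows "rel E \<in> PERs"
proof -
  obtain T t C \<psi> where E: "E = (T, t)" "is_ext X T t" "tych T" "canon T t C \<psi>" "S \<subseteq> C"
    using repsE[OF assms] by metis
  have CK: "C \<subseteq> topspace K" "closedin K C" "C \<inter> eX = {}"
    using canon_closed[OF E(4)] closedin_subset canon_disjoint[OF E(4)] by blast+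
  let ?C = "subtopology K C"
  have "continuous_map (subtopology (subtopology K (eX \<union> C)) C) T \<psi>"
    by (rule continuous_map_from_subtopology[OF perfect_imp_continuous_map[OF canon_perfect[OF E(4)]]])
  moreover have "subtopology (subtopology K (eX \<union> C)) C = ?C"
    by (simp add: subtopology_subtopology Int_absorb1)
  ultimately have "continuous_map ?C T \<psi>" by simp
  then have "continuous_map (prod_topology ?C ?C) T (\<psi> \<circ> fst)" "continuous_map (prod_topology ?C ?C) T (\<psi> \<circ> snd)"
    using continuous_map_compose continuous_map_fst continuous_map_snd by blast+
  moreover have "Hausdorff_space T" using E(3) unfolding tych_def by blast
  ultimately have "closedin (prod_topology ?C ?C) {z \<in> topspace (prod_topology ?C ?C). (\<psi> \<circ> fst) z = (\<psi> \<circ> snd) z}"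
    using closedin_continuous_maps_eq by blast
  moreover have "{z \<in> topspace (prod_topology ?C ?C). (\<psi> \<circ> fst) z = (\<psi> \<circ> snd) z} = rel E"
    unfolding E(1) rel_canon[OF E(4)] using CK(1) by auto
  moreover have "closedin (prod_topology K K) (C \<times> C)" using CK(2) by (simp add: closedin_prod_Times_iff)
  ultimately have "closedin (prod_topology K K) (rel E)"
    unfolding subtopology_Times[symmetric] by (simp add: closedin_closed_subtopology)
  moreover have "rel E \<subseteq> (topspace K - eX) \<times> (topspace K - eX)"
    unfolding E(1) rel_canon[OF E(4)] using CK by blast
  moreover have "sym (rel E)" "trans (rel E)" "Id_on S \<subseteq> rel E"
    unfolding E(1) rel_canon[OF E(4)] using E(5) by (auto simp: sym_def trans_def)
  ultimately show ?thesis unfolding closed_pers_def by simp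
qed

lemma canon_subspace:
  assumes "canon T t C \<psi>" "C' \<subseteq> C"
  shows "continuous_map (subtopology K (eX \<union> C')) T \<psi>"
proof -
  have "continuous_map (subtopology (subtopology K (eX \<union> C)) (eX \<union> C')) T \<psi>"
    by (rule continuous_map_from_subtopology[OF perfect_imp_continuous_map[OF canon_perfect[OF assms(1)]]])
  moreover have "(eX \<union> C) \<inter> (eX \<union> C') = eX \<union> C'" using assms(2) by blast
  ultimately show ?thesis by (simp add: subtopology_subtopology)
qed

text \<open>A map of extensions composed with \<open>\<psi>'\<close> competes in the maximality
  clause for \<open>\<psi>\<close>, so fibres of \<open>\<psi>'\<close> lie in fibres of
  \<open>\<psi>\<close>. Conversely \<open>\<psi>\<close> is then constant on the fibres of
  \<open>\<psi>'\<close>, which is perfect and hence a quotient map, so \<open>\<psi>\<close>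
  factors through it.\<close>

lemma ext_le_iff_rel:
  assumes "E \<in> reps" "E' \<in> reps"
  shows "ext_le X E E' \<longleftrightarrow> rel E' \<subseteq> rel E"
proof -
  obtain T t C \<psi> where E: "E = (T, t)" "canon T t C \<psi>" using repsE[OF assms(1)] by metis
  obtain T' t' C' \<psi>' where E': "E' = (T', t')" "canon T' t' C' \<psi>'" "is_ext X T' t'" using repsE[OF assms(2)] by metis
  have C'K: "C' \<subseteq> topspace K" "C' \<inter> eX = {}" and CX: "C \<inter> eX = {}"
    using canon_closed[OF E'(2)] closedin_subset canon_disjoint[OF E'(2)] canon_disjoint[OF E(2)] by blast+
  have tD: "topspace (subtopology K (eX \<union> C')) = eX \<union> C'" using C'K(1) eX_sub by auto
  have p': "perfect_map (subtopology K (eX \<union> C')) T' \<psi>'" by (rule canon_perfect[OF E'(2)])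
  show ?thesis
  proof
    assume "ext_le X E E'"
    then obtain f where f: "continuous_map T' T f" "\<And>x. x \<in> topspace X \<Longrightarrow> f (t' x) = t x"
      unfolding ext_le_def E(1) E'(1) by auto
    have "continuous_map (subtopology K (eX \<union> C')) T (f \<circ> \<psi>')"
      using continuous_map_compose[OF perfect_imp_continuous_map[OF p'] f(1)] .
    moreover have "(f \<circ> \<psi>') (e x) = t x" if "x \<in> topspace X" for x
      using canon_e[OF E'(2) that] f(2)[OF that] by simp
    ultimately have *: "C' \<subseteq> C \<and> (\<forall>k\<in>C'. (f \<circ> \<psi>') k = \<psi> k)" by (rule canon_max[OF E(2) C'K])
    show "rel E' \<subseteq> rel E"
      unfolding E(1) E'(1) rel_canon[OF E(2)] rel_canon[OF E'(2)]
    proof clarify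
      fix k l assume kl: "k \<in> C'" "l \<in> C'" "\<psi>' k = \<psi>' l"
      then have "\<psi> k = \<psi> l" using * by (metis comp_apply)
      then show "k \<in> C \<and> l \<in> C \<and> \<psi> k = \<psi> l" using kl * by blast
    qed
  next
    assume "rel E' \<subseteq> rel E"
    then have le: "k \<in> C \<and> l \<in> C \<and> \<psi> k = \<psi> l" if "k \<in> C'" "l \<in> C'" "\<psi>' k = \<psi>' l" for k l
      using that unfolding E(1) E'(1) rel_canon[OF E(2)] rel_canon[OF E'(2)] by blast
    then have "C' \<subseteq> C" by blast
    then have c: "continuous_map (subtopology K (eX \<union> C')) T \<psi>" by (rule canon_subspace[OF E(2)])
    have inj: "inj_on t' (topspace X)"
      using E'(3) homeomorphic_imp_injective_map unfolding is_ext_def embedding_map_def by blast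
    \<comment> \<open>Fibres never mix \<open>eX\<close> with \<open>C'\<close>, whose image is the
      remainder, and over points of X they are singletons because \<open>t'\<close> is
      injective.\<close>
    have fib: "\<psi> k = \<psi> l" if "k \<in> topspace (subtopology K (eX \<union> C'))" "l \<in> topspace (subtopology K (eX \<union> C'))"
      "\<psi>' k = \<psi>' l" for k l
    proof -
      have out: "\<psi>' m \<notin> t' ` topspace X" if "m \<in> C'" for m using canon_image[OF E'(2)] that by blast
      have in': "\<psi>' m \<in> t' ` topspace X" if "m \<in> eX" for m
        using that canon_e[OF E'(2)] by auto
      note eq = that(3)
      have kl: "k \<in> eX \<union> C'" "l \<in> eX \<union> C'" using that tD by blast+
      then consider "k \<in> C'" "l \<in> C'" | x y where "x \<in> topspace X" "y \<in> topspace X" "k = e x" "l = e y"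
        using out in' eq by (metis UnE imageE)
      then show ?thesis
      proof cases
        case 1
        then show ?thesis using le that(3) by blast
      next
        case 2
        then have "t' x = t' y" using canon_e[OF E'(2)] that(3) by simp
        then have "x = y" using inj 2 by (simp add: inj_on_eq_iff)
        then show ?thesis using 2 by simp
      qed
    qed
    obtain f where f: "continuous_map T' T f" "\<And>k. k \<in> topspace (subtopology K (eX \<union> C')) \<Longrightarrow> f (\<psi>' k) = \<psi> k"
      by (rule quotient_map_lift_exists[OF perfect_imp_quotient_map[OF p'] c]) (use fib in blast)+
    have "f (t' x) = t x" if x: "x \<in> topspace X" for x
      using f(2)[of "e x"] x tD canon_e[OF E'(2) x] canon_e[OF E(2) x] by auto
    then show "ext_le X E E'" unfolding ext_le_def E(1) E'(1) using f(1) by auto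
  qed
qed

text \<open>Antisymmetry: maps in both directions fixing X are mutually inverse, since their
  composites are the identity on a dense set.\<close>

lemma ext_eq_iff_rel:
  assumes "E \<in> reps" "E' \<in> reps"
  shows "ext_eq X E E' \<longleftrightarrow> rel E = rel E'"
proof -
  obtain T t where E: "E = (T, t)" "is_ext X T t" "tych T" using repsE[OF assms(1)] by metis
  obtain T' t' where E': "E' = (T', t')" "is_ext X T' t'" "tych T'" using repsE[OF assms(2)] by metis
  have tT: "t x \<in> topspace T" if "x \<in> topspace X" for x
  proof -
    have "t ` topspace X \<subseteq> topspace T"
      using E(2) unfolding is_ext_def embedding_map_def
      by (auto dest!: homeomorphic_imp_continuous_map continuous_map_image_subset_topspace)
    then show ?thesis using that by blast
  qed
  show ?thesis
  proof
    assume "ext_eq X E E'"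
    then obtain h where h: "homeomorphic_map T T' h" "\<And>x. x \<in> topspace X \<Longrightarrow> h (t x) = t' x"
      unfolding ext_eq_def E(1) E'(1) by auto
    then obtain k where k: "homeomorphic_maps T T' h k" unfolding homeomorphic_map_maps by blast
    have "k (t' x) = t x" if "x \<in> topspace X" for x
    proof -
      have "k (h (t x)) = t x" using k tT[OF that] unfolding homeomorphic_maps_def by blast
      then show ?thesis using h(2)[OF that] by simp
    qed
    then have "ext_le X E E'" "ext_le X E' E"
      using h(2) k unfolding ext_le_def E(1) E'(1) homeomorphic_maps_def by auto
    then show "rel E = rel E'" using ext_le_iff_rel assms by blast
  next
    assume "rel E = rel E'"
    then have "ext_le X E E'" "ext_le X E' E" using ext_le_iff_rel assms by blast+
    then obtain f f' where f: "continuous_map T' T f" "\<And>x. x \<in> topspace X \<Longrightarrow> f (t' x) = t x"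
      and f': "continuous_map T T' f'" "\<And>x. x \<in> topspace X \<Longrightarrow> f' (t x) = t' x"
      unfolding ext_le_def E(1) E'(1) by auto
    have id1: "f (f' y) = y" if y: "y \<in> topspace T" for y
    proof -
      have "y \<in> T closure_of (t ` topspace X)" using E(2) y unfolding is_ext_def by blast
      then have "(f \<circ> f') y = id y"
      proof (rule forall_in_closure_of_eq)
        show "Hausdorff_space T" using E(3) unfolding tych_def by blast
        show "continuous_map T T (f \<circ> f')" using f'(1) f(1) by (rule continuous_map_compose)
      qed (use f f' in auto)
      then show ?thesis by simp
    qed
    have id2: "f' (f y) = y" if y: "y \<in> topspace T'" for y
    proof -
      have "y \<in> T' closure_of (t' ` topspace X)" using E'(2) y unfolding is_ext_def by blast
      then have "(f' \<circ> f) y = id y"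
      proof (rule forall_in_closure_of_eq)
        show "Hausdorff_space T'" using E'(3) unfolding tych_def by blast
        show "continuous_map T' T' (f' \<circ> f)" using f(1) f'(1) by (rule continuous_map_compose)
      qed (use f f' in auto)
      then show ?thesis by simp
    qed
    have "homeomorphic_maps T T' f' f"
      unfolding homeomorphic_maps_def using f(1) f'(1) id1 id2 by blast
    then have "homeomorphic_map T T' f'" unfolding homeomorphic_map_maps by blast
    then show "ext_eq X E E'" unfolding ext_eq_def E(1) E'(1) using f'(2) by auto
  qed
qed

text \<open>The classes of \<open>r\<close> are collapsed in all of \<open>K\<close>, where
  compactness yields a Hausdorff quotient; \<open>T\<close> is the image of \<open>eX\<close>
  together with the domain of \<open>r\<close>.\<close>

lemma rel_surj:
  assumes r: "r \<in> PERs"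
  shows "\<exists>E\<in>reps. rel E = r"
proof -
  have rc: "closedin (prod_topology K K) r" "r \<subseteq> (topspace K - eX) \<times> (topspace K - eX)" "sym r" "trans r" "Id_on S \<subseteq> r"
    using r by (simp_all add: closed_pers_def)
  define C where "C = {k \<in> topspace K. (k, k) \<in> r}"
  have C_iff: "k \<in> C \<longleftrightarrow> (k, k) \<in> r" for k using rc(2) unfolding C_def by blast
  have rC: "k \<in> C \<and> l \<in> C" if "(k, l) \<in> r" for k l
    using that symD[OF rc(3)] transD[OF rc(4)] C_iff by metis
  have C_closed: "closedin K C" unfolding C_def
    by (rule closedin_continuous_map_preimage[OF _ rc(1)]) (simp add: continuous_map_pairwise o_def)
  have CX: "C \<inter> eX = {}" using rc(2) C_iff by blast
  have CK: "C \<subseteq> topspace K" unfolding C_def by blast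
  have SC: "S \<subseteq> C" using rc(5) C_iff by blast
  \<comment> \<open>Related points determine the same predicate under \<open>SOME\<close>, hence the
    same representative.\<close>
  define rep where "rep k = (if k \<in> C then (SOME l. (k, l) \<in> r) else k)" for k
  have rep_r: "(k, rep k) \<in> r" if "k \<in> C" for k
  proof -
    have "(k, k) \<in> r" using that C_iff by blast
    then have "(k, SOME l. (k, l) \<in> r) \<in> r" by (rule someI)
    then show ?thesis using that by (simp add: rep_def)
  qed
  have repC: "rep k \<in> C" if "k \<in> C" for k using rC[OF rep_r[OF that]] by blast
  have repK: "rep k \<in> topspace K" if "k \<in> topspace K" for k
  proof (cases "k \<in> C")
    case True
    then show ?thesis using repC CK by blast
  qed (use that in \<open>simp add: rep_def\<close>)
  \<comment> \<open>Coding the representatives gives the quotient the carrier type on which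
    \<open>reps\<close> is formed.\<close>
  define q where "q k = point_code (rep k)" for k
  have q: "q x = q y \<longleftrightarrow> x = y \<or> (x, y) \<in> r" if xy: "x \<in> topspace K" "y \<in> topspace K" for x y
  proof -
    have "q x = q y \<longleftrightarrow> rep x = rep y"
      unfolding q_def using inj_on_eq_iff[OF point_code_inj repK[OF xy(1)] repK[OF xy(2)]] .
    also have "\<dots> \<longleftrightarrow> x = y \<or> (x, y) \<in> r"
    proof
      assume eq: "rep x = rep y"
      show "x = y \<or> (x, y) \<in> r"
      proof (cases "x \<in> C \<or> y \<in> C")
        case True
        then have "x \<in> C" "y \<in> C" using repC eq unfolding rep_def by metis+
        then have "(x, rep x) \<in> r" "(rep x, y) \<in> r" using rep_r symD[OF rc(3)] eq by metis+
        then show ?thesis using transD[OF rc(4)] by blast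
      next
        case False
        then show ?thesis using eq unfolding rep_def by simp
      qed
    next
      assume "x = y \<or> (x, y) \<in> r"
      then show "rep x = rep y"
      proof
        assume xyr: "(x, y) \<in> r"
        then have "(\<lambda>l. (x, l) \<in> r) = (\<lambda>l. (y, l) \<in> r)"
          using symD[OF rc(3)] transD[OF rc(4)] by metis
        then show ?thesis using rC[OF xyr] unfolding rep_def by simp
      qed simp
    qed
    finally show ?thesis .
  qed
  have ker: "closedin (prod_topology K K) {(x,y) \<in> topspace K \<times> topspace K. q x = q y}"
    using closed_kernel[OF K_Hausdorff rc(1) q] by blast
  define Q where "Q = quotient_top K q"
  have pQ: "perfect_map K Q q" unfolding Q_def by (rule perfect_map_quotient_top[OF K_compact K_Hausdorff ker])
  have contq: "continuous_map K Q q" by (rule perfect_imp_continuous_map[OF pQ])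
  have HQ: "Hausdorff_space Q" unfolding Q_def by (rule Hausdorff_space_quotient_top[OF K_compact K_Hausdorff ker])
  have cQ: "compact_space Q" unfolding Q_def by (rule compact_space_quotient_top[OF K_compact])
  have topQ: "topspace Q = q ` topspace K" by (simp add: Q_def topspace_quotient_top)
  define B where "B = q ` (eX \<union> C)"
  have BQ: "B \<subseteq> topspace Q" unfolding B_def topQ using eX_sub CK by blast
  define T where "T = subtopology Q B"
  define t where "t = q \<circ> e"
  have tT: "topspace T = B" unfolding T_def using BQ by auto
  have tX: "t ` topspace X = q ` eX" unfolding t_def by (simp add: image_comp)
  \<comment> \<open>Points of X lie outside the domain of \<open>r\<close>, so they are not
    identified with anything.\<close>
  have qX: "x = y" if "x \<in> topspace K" "y \<in> eX" "q x = q y" for x y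
  proof -
    have "y \<in> topspace K" "y \<notin> C" using that CX eX_sub by blast+
    then show ?thesis using q[of x y] that rC by blast
  qed
  have qC: "x \<in> C" if "x \<in> topspace K" "y \<in> C" "q x = q y" for x y
    using q[of x y] that rC CK by blast
  have "perfect_map (subtopology K eX) (subtopology Q (q ` eX)) q"
  proof (rule perfect_map_restriction[OF pQ])
    show "{k \<in> topspace K. q k \<in> q ` eX} = eX"
    proof
      show "{k \<in> topspace K. q k \<in> q ` eX} \<subseteq> eX"
      proof clarify
        fix k x assume "k \<in> topspace K" "q k = q (e x)" "x \<in> topspace X"
        then show "k \<in> eX" using qX[of k "e x"] by blast
      qed
      show "eX \<subseteq> {k \<in> topspace K. q k \<in> q ` eX}" using eX_sub by blast
    qed
    show "q ` eX \<subseteq> topspace Q" using topQ eX_sub by blast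
  qed
  moreover have "inj_on q (topspace (subtopology K eX))"
  proof (rule inj_onI)
    fix x y assume "x \<in> topspace (subtopology K eX)" "y \<in> topspace (subtopology K eX)" "q x = q y"
    then show "x = y" using qX[of x y] by simp
  qed
  ultimately have "homeomorphic_map (subtopology K eX) (subtopology Q (q ` eX)) q"
    unfolding homeomorphic_eq_injective_perfect_map by blast
  then have "homeomorphic_map X (subtopology Q (q ` eX)) t"
    unfolding t_def using hom homeomorphic_map_compose by blast
  moreover have "subtopology T (t ` topspace X) = subtopology Q (q ` eX)"
    unfolding T_def tX subtopology_subtopology B_def by (simp add: image_Un Int_absorb1)
  ultimately have emb': "embedding_map X T t" unfolding embedding_map_def by simp
  have "T closure_of (t ` topspace X) = topspace T"
  proof (rule antisym[OF closure_of_subset_topspace])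
    have "B \<subseteq> Q closure_of (q ` eX)"
    proof -
      have "q ` (K closure_of eX) \<subseteq> Q closure_of (q ` eX)"
        using contq by (rule continuous_map_image_closure_subset)
      then show ?thesis unfolding dense B_def using eX_sub CK by blast
    qed
    moreover have "B \<inter> q ` eX = q ` eX" unfolding B_def by blast
    ultimately show "topspace T \<subseteq> T closure_of (t ` topspace X)"
      unfolding tT unfolding T_def tX closure_of_subtopology by simp
  qed
  moreover have "tych T" unfolding T_def by (intro tych_subtopology tych_compact_Hausdorff cQ HQ)
  ultimately have ext: "is_ext X T t" unfolding is_ext_def using emb' by blast
  have rem: "topspace T - t ` topspace X = q ` C"
  proof
    show "topspace T - t ` topspace X \<subseteq> q ` C" unfolding tT tX B_def by blast
    show "q ` C \<subseteq> topspace T - t ` topspace X"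
    proof
      fix z assume "z \<in> q ` C"
      then obtain k where k: "k \<in> C" "z = q k" by blast
      have "z \<notin> q ` eX"
      proof
        assume "z \<in> q ` eX"
        then obtain y where y: "y \<in> eX" "q k = q y" using k by blast
        then have "k = y" using qX[of k y] k CK by blast
        then show False using y k CX by blast
      qed
      then show "z \<in> topspace T - t ` topspace X" unfolding tT tX B_def using k by blast
    qed
  qed
  have "compactin Q (q ` C)"
    by (rule image_compactin[OF closedin_compact_space[OF K_compact C_closed] contq])
  then have com: "compactin T (topspace T - t ` topspace X)"
    unfolding rem unfolding T_def compactin_subtopology B_def by blast
  have "embedding_map T Q id"
    unfolding T_def embedding_map_def topspace_subtopology by (simp add: Int_absorb1 BQ)
  moreover have "q (e x) = id (t x)" for x by (simp add: t_def)
  ultimately obtain \<psi> where \<psi>: "canon T t {k \<in> topspace K. q k \<in> id ` (topspace T - t ` topspace X)} \<psi>"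
    "\<And>k. k \<in> topspace K \<Longrightarrow> q k \<in> id ` topspace T \<Longrightarrow> id (\<psi> k) = q k"
    by (rule canon_from_map[OF ext com HQ contq]) blast
  have "{k \<in> topspace K. q k \<in> id ` (topspace T - t ` topspace X)} = C"
  proof
    show "{k \<in> topspace K. q k \<in> id ` (topspace T - t ` topspace X)} \<subseteq> C"
      unfolding rem image_id id_apply using qC by blast
    show "C \<subseteq> {k \<in> topspace K. q k \<in> id ` (topspace T - t ` topspace X)}"
      unfolding rem image_id id_apply using CK by blast
  qed
  then have can: "canon T t C \<psi>" using \<psi>(1) by simp
  have \<psi>q: "\<psi> k = q k" if "k \<in> C" for k
    using \<psi>(2)[of k] that CK tT unfolding B_def by auto
  have "hasP P T" using hasP_iff_canon[OF can \<open>tych T\<close>] SC by blast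
  then have "(T, t) \<in> reps" unfolding EP_reps_def using ext com by blast
  moreover have "rel (T, t) = r"
  proof -
    have "(k, l) \<in> rel (T, t) \<longleftrightarrow> (k, l) \<in> r" for k l
    proof -
      have "(k, l) \<in> rel (T, t) \<longleftrightarrow> k \<in> C \<and> l \<in> C \<and> q k = q l"
        unfolding rel_canon[OF can] using \<psi>q by auto
      also have "\<dots> \<longleftrightarrow> (k, l) \<in> r" using q[of k l] CK rC[of k l] C_iff by blast
      finally show ?thesis .
    qed
    then show ?thesis by auto
  qed
  ultimately show ?thesis by blast
qed

section \<open>Classes of equivalent extensions\<close>

abbreviation EPX :: "('a set set topology \<times> ('a \<Rightarrow> 'a set set)) set set" where "EPX \<equiv> EP P X"

text \<open>By \<open>ext_eq_iff_rel\<close> all members of a class have the same relation, so the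
  choice of representative is immaterial.\<close>

definition class_rel :: "('a set set topology \<times> ('a \<Rightarrow> 'a set set)) set \<Rightarrow> ('k \<times> 'k) set" where
  "class_rel A = rel (SOME E. E \<in> A)"

lemma EPX_classes:
  assumes "A \<in> EPX"
  shows "A = {E \<in> reps. rel E = class_rel A}" "A \<noteq> {}"
proof -
  obtain E where E: "E \<in> reps" "A = {E' \<in> reps. ext_eq X E E'}" using assms unfolding EP_def by blast
  have A: "A = {E' \<in> reps. rel E = rel E'}" unfolding E(2) using ext_eq_iff_rel[OF E(1)] by blast
  then have "E \<in> A" using E(1) by blast
  then show "A \<noteq> {}" by blast
  have "(SOME E. E \<in> A) \<in> A" using \<open>E \<in> A\<close> by (rule someI)
  then have "class_rel A = rel E" unfolding class_rel_def using A by auto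
  then show "A = {E \<in> reps. rel E = class_rel A}" using A by auto
qed

lemma class_rel_bij: "bij_betw class_rel EPX PERs"
  unfolding bij_betw_def
proof
  show "inj_on class_rel EPX"
  proof (rule inj_onI)
    fix A B assume "A \<in> EPX" "B \<in> EPX" "class_rel A = class_rel B"
    then show "A = B" using EPX_classes(1)[of A] EPX_classes(1)[of B] by simp
  qed
  show "class_rel ` EPX = PERs"
  proof
    show "class_rel ` EPX \<subseteq> PERs"
    proof clarify
      fix A assume A: "A \<in> EPX"
      then obtain E where "E \<in> A" using EPX_classes(2) by blast
      then have "E \<in> reps" "rel E = class_rel A" using EPX_classes(1)[OF A] by blast+
      then show "class_rel A \<in> PERs" using rel_in[of E] by simp
    qed
    show "PERs \<subseteq> class_rel ` EPX"
    proof
      fix r assume "r \<in> PERs"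
      then obtain E where E: "E \<in> reps" "rel E = r" using rel_surj by blast
      let ?A = "{E' \<in> reps. ext_eq X E E'}"
      have A: "?A \<in> EPX" unfolding EP_def using E(1) by blast
      have "E \<in> ?A" using ext_eq_iff_rel[OF E(1) E(1)] E(1) by simp
      then have "rel E = class_rel ?A" using EPX_classes(1)[OF A] by blast
      then show "r \<in> class_rel ` EPX" using A E(2) by blast
    qed
  qed
qed

lemma EP_le_iff:
  assumes "A \<in> EPX" "B \<in> EPX"
  shows "EP_le X A B \<longleftrightarrow> class_rel B \<subseteq> class_rel A"
proof -
  have m: "E \<in> reps \<and> rel E = class_rel A" if "E \<in> A" for E using EPX_classes(1)[OF assms(1)] that by blast
  have n: "E \<in> reps \<and> rel E = class_rel B" if "E \<in> B" for E using EPX_classes(1)[OF assms(2)] that by blast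
  obtain E E' where EE': "E \<in> A" "E' \<in> B" using EPX_classes(2) assms by blast
  have *: "ext_le X F F' \<longleftrightarrow> class_rel B \<subseteq> class_rel A" if "F \<in> A" "F' \<in> B" for F F'
    using ext_le_iff_rel m[OF that(1)] n[OF that(2)] by metis
  show ?thesis unfolding EP_le_def using * EE' by blast
qed

lemma pers_axioms: "pers K (topspace K - eX) S"
  using K_Hausdorff S_closed eX_lam S_nonempty by unfold_locales auto

end

lemma homeomorphic_of_EP_iso:
  assumes X: "sc_space P X KX eX gX" and Y: "sc_space P Y KY eY gY"
    and iso: "order_isomorphic_EP X (EP P X :: ('a set set topology \<times> ('a \<Rightarrow> 'a set set)) set set)
                             Y (EP P Y :: ('b set set topology \<times> ('b \<Rightarrow> 'b set set)) set set)"
  shows "subtopology KX (topspace KX - lambdaP P X KX eX) homeomorphic_space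
         subtopology KY (topspace KY - lambdaP P Y KY eY)"
proof -
  interpret X: sc_space P X KX eX gX by fact
  interpret Y: sc_space P Y KY eY gY by fact
  obtain \<phi> where \<phi>: "bij_betw \<phi> X.EPX Y.EPX"
    "\<And>A B. A \<in> X.EPX \<Longrightarrow> B \<in> X.EPX \<Longrightarrow> EP_le X A B \<longleftrightarrow> EP_le Y (\<phi> A) (\<phi> B)"
    using iso unfolding order_isomorphic_EP_def by blast
  define \<iota> where "\<iota> = inv_into X.EPX X.class_rel"
  have \<iota>: "bij_betw \<iota> X.PERs X.EPX" unfolding \<iota>_def by (rule bij_betw_inv_into[OF X.class_rel_bij])
  have \<iota>_in: "\<iota> a \<in> X.EPX" if "a \<in> X.PERs" for a using \<iota> that bij_betwE by blast
  have \<iota>_rel: "X.class_rel (\<iota> a) = a" if "a \<in> X.PERs" for a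
    using X.class_rel_bij that unfolding \<iota>_def by (simp add: bij_betw_inv_into_right)
  define \<Phi> where "\<Phi> = Y.class_rel \<circ> (\<phi> \<circ> \<iota>)"
  have "bij_betw \<Phi> X.PERs Y.PERs"
    unfolding \<Phi>_def by (intro bij_betw_trans[OF bij_betw_trans[OF \<iota> \<phi>(1)] Y.class_rel_bij])
  moreover have "\<Phi> a \<subseteq> \<Phi> b \<longleftrightarrow> a \<subseteq> b" if "a \<in> X.PERs" "b \<in> X.PERs" for a b
  proof -
    have \<phi>_in: "\<phi> (\<iota> a) \<in> Y.EPX" "\<phi> (\<iota> b) \<in> Y.EPX" using \<phi>(1) \<iota>_in that bij_betwE by blast+
    \<comment> \<open>The passages between classes and relations for X and for Y each reverse the
      order, so \<Phi> preserves inclusion.\<close>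
    have "\<Phi> a \<subseteq> \<Phi> b \<longleftrightarrow> EP_le Y (\<phi> (\<iota> b)) (\<phi> (\<iota> a))"
      unfolding \<Phi>_def using Y.EP_le_iff[OF \<phi>_in(2,1)] by simp
    also have "\<dots> \<longleftrightarrow> EP_le X (\<iota> b) (\<iota> a)" using \<phi>(2)[OF \<iota>_in[OF that(2)] \<iota>_in[OF that(1)]] by simp
    also have "\<dots> \<longleftrightarrow> a \<subseteq> b"
      using X.EP_le_iff[OF \<iota>_in[OF that(2)] \<iota>_in[OF that(1)]] \<iota>_rel that by simp
    finally show ?thesis .
  qed
  ultimately show ?thesis
    by (rule closed_pers_determine_space[OF X.pers_axioms Y.pers_axioms])
qed

text \<open>The bit is stored in one further power set, as the choice between a singleton and the
  complement of a singleton. These never coincide, since a double power set has at least three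
  elements.\<close>

lemma inj_set_set_times_bool:
  fixes i :: "'a \<Rightarrow> 'c" and g :: "'c set set set \<Rightarrow> 'u"
  assumes "inj i" "inj g"
  shows "inj (\<lambda>(F, b). g (if b then {(`) i ` F} else - {(`) i ` F}))"
proof -
  have "inj ((`) ((`) i))" using assms(1) by (simp add: inj_image_eq_iff inj_def)
  then have i2: "(`) i ` F = (`) i ` F' \<longleftrightarrow> F = F'" for F F' :: "'a set set" by (simp add: inj_eq)
  have ne: "{z} \<noteq> - {w}" for z w :: "'c set set"
  proof
    assume eq: "{z} = - {w}"
    have zw: "v = z \<or> v = w" for v
    proof (cases "v = w")
      case False
      then have "v \<in> {z}" unfolding eq by simp
      then show ?thesis by simp
    qed simp
    have "(UNIV :: 'c set) \<notin> {{}}" by simp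
    then have "(UNIV :: 'c set set) \<noteq> {{}}" by (metis UNIV_I)
    then show False using zw[of "{}"] zw[of "{{}}"] zw[of UNIV] by (metis UNIV_not_empty insert_not_empty)
  qed
  show ?thesis
  proof (rule injI, clarify)
    fix F F' :: "'a set set" and b b' :: bool
    assume "g (if b then {(`) i ` F} else - {(`) i ` F}) = g (if b' then {(`) i ` F'} else - {(`) i ` F'})"
    then have "(if b then {(`) i ` F} else - {(`) i ` F}) = (if b' then {(`) i ` F'} else - {(`) i ` F'})"
      using assms(2) by (simp add: inj_eq)
    then show "F = F' \<and> b = b'"
      using ne[of "(`) i ` F" "(`) i ` F'"] ne[of "(`) i ` F'" "(`) i ` F"] i2[of F F']
      by (cases b; cases b') auto
  qed
qed

text \<open>If the empty space lacks \<open>P\<close>, then no Tychonoff space has \<open>P\<close>, since the empty set is clopen;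
  a locally-\<open>P\<close> space is then empty.\<close>

lemma empty_if_not_hasP_empty:
  assumes P: "compactness_like P" and X: "topspace X = {}" "\<not> hasP P X"
    and Y: "tych Y" "locally_P P Y"
  shows "topspace Y = {}"
proof (rule ccontr)
  assume "topspace Y \<noteq> {}"
  then obtain y where "y \<in> topspace Y" by blast
  then obtain U where U: "hasP P (subtopology Y (Y closure_of U))" using Y(2) unfolding locally_P_def by blast
  let ?Z = "subtopology Y (Y closure_of U)"
  have "hasP P (subtopology ?Z {})"
    by (rule hasP_clopen[OF P tych_subtopology[OF Y(1)] U]) auto
  moreover have "subtopology ?Z {} homeomorphic_space X"
    unfolding homeomorphic_space_def homeomorphic_maps_def using X(1)
    by (auto simp: continuous_map_def)
  ultimately show False using X(2) hasP_homeomorphic by blast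
qed

lemma stone_cech_empty: "stone_cech X K e \<Longrightarrow> topspace X = {} \<Longrightarrow> topspace K = {}"
  unfolding stone_cech_def by auto

theorem theorem4p12:
  fixes P :: "'u topology \<Rightarrow> bool"
    and X :: "'a topology" and Y :: "'b topology"
    and KX :: "'c topology" and eX :: "'a \<Rightarrow> 'c"
    and KY :: "'d topology" and eY :: "'b \<Rightarrow> 'd"
  assumes "compactness_like P"
    and "\<exists>g :: ('a + 'b) set set set \<Rightarrow> 'u. inj g"
    and "tych X" and "tych Y"
    and "locally_P P X" and "locally_P P Y"
    and "\<not> hasP P X" and "\<not> hasP P Y"
    and "stone_cech X KX eX" and "stone_cech Y KY eY"
    and "order_isomorphic_EP X (EP P X :: ('a set set topology \<times> ('a \<Rightarrow> 'a set set)) set set)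
                             Y (EP P Y :: ('b set set topology \<times> ('b \<Rightarrow> 'b set set)) set set)"
  shows "subtopology KX (topspace KX - lambdaP P X KX eX) homeomorphic_space
         subtopology KY (topspace KY - lambdaP P Y KY eY)"
proof (cases "topspace X = {}")
  case True
  \<comment> \<open>An empty X without the property means that the empty space lacks it, which
    forces Y to be empty too; both compactifications are then empty.\<close>
  then have "topspace Y = {}"
    using empty_if_not_hasP_empty[OF assms(1) _ assms(7,4,6)] by blast
  then have "topspace KX = {}" "topspace KY = {}"
    using True stone_cech_empty assms(9,10) by blast+
  then show ?thesis
    unfolding homeomorphic_space_def homeomorphic_maps_def by (auto simp: continuous_map_def)
next
  case False
  then have Y: "topspace Y \<noteq> {}"
    using empty_if_not_hasP_empty[OF assms(1) _ assms(8,3,5)] by blast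
  \<comment> \<open>The sum type lets one injection serve both spaces, through \<open>Inl\<close>
    and \<open>Inr\<close>.\<close>
  obtain g :: "('a + 'b) set set set \<Rightarrow> 'u" where g: "inj g" using assms(2) by blast
  show ?thesis
  proof (rule homeomorphic_of_EP_iso[OF _ _ assms(11)])
    show "sc_space P X KX eX (\<lambda>(F, b). g (if b then {(`) Inl ` F} else - {(`) Inl ` F}))"
      using assms False inj_set_set_times_bool[OF inj_Inl g] by unfold_locales auto
    show "sc_space P Y KY eY (\<lambda>(F, b). g (if b then {(`) Inr ` F} else - {(`) Inr ` F}))"
      using assms Y inj_set_set_times_bool[OF inj_Inr g] by unfold_locales auto
  qed
qed

end
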